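(* Let $\mathbb{F}_q$ be a finite field of characteristic $>3$. Let $N_a$ be the number of $\overline{\mathbb{F}}_q$-isomorphism classes of Jacobi quartic curves $E_a: y^2=x^4+ax^2+1$ with $a\in\mathbb{F}_q$, $a^2\neq 4$ (that is, the number of classes into which the set of all such curves, as $a$ varies, is partitioned by isomorphism over $\overline{\mathbb{F}}_q$). Then $$N_a=\begin{cases} \dfrac{q+5}{6}, & \text{if } q\equiv 1,7 \pmod{12},\\[2ex] \dfrac{q+1}{6}, & \text{if } q\equiv 5,11 \pmod{12}.\end{cases}$$
   Context: $\mathbb{F}_q$ is the finite field with $q$ elements and $\overline{\mathbb{F}}_q$ its algebraic closure. A Jacobi quartic curve over $\mathbb{F}_q$ is $E_a: y^2=x^4+ax^2+1$ with $a\in\mathbb{F}_q$, $a^2\neq 4$. It is regarded as an elliptic curve, i.e. through the smooth projective genus one curve birational to it; it is birationally equivalent to the curve $v^2=u(u-1)\left(u-\frac{2-a}{4}\right)$. Its $j$-invariant is that of this curve, namely $j(E_a)=\frac{16(a^2+12)^3}{(a^2-4)^2}$. Two such curves are isomorphic over $\overline{\mathbb{F}}_q$ if the corresponding elliptic curves are isomorphic over $\overline{\mathbb{F}}_q$, equivalently if they have the same $j$-invariant; thus the number of isomorphism classes is the number of distinct $j$-invariants. *)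

theory Defs
  imports "HOL-Algebra.Algebraic_Closure_Type" "HOL-Library.Cardinality"
begin

text \<open>
  A point of the projective plane over \<^typ>\<open>'k\<close> is the set of all its homogeneous coordinate
  triples, i.e. the orbit of a nonzero triple under scaling by nonzero constants.
\<close>

definition proj_pt :: "'k::field \<times> 'k \<times> 'k \<Rightarrow> ('k \<times> 'k \<times> 'k) set" where
  "proj_pt = (\<lambda>(x, y, z). {(c * x, c * y, c * z) | c. c \<noteq> 0})"

text \<open>
  Value of the form of degree \<open>d\<close> in three variables whose coefficient at
  \<open>X ^ i * Y ^ j * Z ^ (d - i - j)\<close> is \<open>F i j\<close> (coefficients with \<open>i + j > d\<close> are ignored).
\<close>

definition form_eval :: "nat \<Rightarrow> (nat \<Rightarrow> nat \<Rightarrow> 'k::field) \<Rightarrow> 'k \<times> 'k \<times> 'k \<Rightarrow> 'k" where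
  "form_eval d F = (\<lambda>(x, y, z). \<Sum>i\<le>d. \<Sum>j\<le>d - i. F i j * x ^ i * y ^ j * z ^ (d - i - j))"

text \<open>
  Morphisms between subvarieties of the projective plane over an algebraically closed field,
  given by their point sets: on a Zariski neighbourhood (the locus \<open>H \<noteq> 0\<close>) of each point,
  the map is given by three forms of the same degree without common zero there.
  Every triple \<open>w\<close> with \<open>proj_pt w \<in> C\<close> is nonzero if \<open>C\<close> consists of projective points.
\<close>

definition proj_morphism ::
  "('k::field \<times> 'k \<times> 'k) set set \<Rightarrow> ('k \<times> 'k \<times> 'k) set set \<Rightarrow>
     (('k \<times> 'k \<times> 'k) set \<Rightarrow> ('k \<times> 'k \<times> 'k) set) \<Rightarrow> bool" where
  "proj_morphism C D f \<longleftrightarrow> f ` C \<subseteq> D \<and>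
     (\<forall>v. proj_pt v \<in> C \<longrightarrow>
        (\<exists>e H d F\<^sub>1 F\<^sub>2 F\<^sub>3. form_eval e H v \<noteq> 0 \<and>
           (\<forall>w. proj_pt w \<in> C \<and> form_eval e H w \<noteq> 0 \<longrightarrow>
              (form_eval d F\<^sub>1 w, form_eval d F\<^sub>2 w, form_eval d F\<^sub>3 w) \<noteq> (0, 0, 0) \<and>
              f (proj_pt w) =
                proj_pt (form_eval d F\<^sub>1 w, form_eval d F\<^sub>2 w, form_eval d F\<^sub>3 w))))"

text \<open>
  The projective closure of \<open>v\<^sup>2 = u (u - 1) (u - l)\<close>; it is smooth iff \<open>l \<notin> {0, 1}\<close>
  (in characteristic other than 2).
\<close>

definition legendre_curve :: "'k::field \<Rightarrow> ('k \<times> 'k \<times> 'k) set set" where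
  "legendre_curve l =
     {proj_pt (x, y, z) | x y z. (x, y, z) \<noteq> (0, 0, 0) \<and> y ^ 2 * z = x * (x - z) * (x - l * z)}"

definition point_O :: "('k::field \<times> 'k \<times> 'k) set" where
  "point_O = proj_pt (0, 1, 0)"

text \<open>Isomorphism of elliptic curves: an isomorphism of projective curves respecting the origins.\<close>

definition elliptic_iso ::
  "('k::field \<times> 'k \<times> 'k) set set \<Rightarrow> ('k \<times> 'k \<times> 'k) set set \<Rightarrow> bool" where
  "elliptic_iso C D \<longleftrightarrow>
     (\<exists>f. bij_betw f C D \<and> proj_morphism C D f \<and> proj_morphism D C (inv_into C f) \<and>
          f point_O = point_O)"

definition jacobi_affine :: "'k::field \<Rightarrow> ('k \<times> 'k) set" where
  "jacobi_affine a = {(x, y). y ^ 2 = x ^ 4 + a * x ^ 2 + 1}"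

text \<open>The elliptic curve (smooth projective model) corresponding to \<open>jacobi_affine a\<close>.\<close>

definition jacobi_elliptic :: "'k::field \<Rightarrow> ('k \<times> 'k \<times> 'k) set set" where
  "jacobi_elliptic a = legendre_curve ((2 - a) / 4)"

text \<open>
  The lemma below makes the birational equivalence explicit: the first map is polynomial, the
  second one rational, they are mutually inverse, and only the point \<open>((2 - a) / 4, 0)\<close> of the
  affine part of the cubic is not reached.
\<close>

lemma jacobi_affine_birational:
  fixes a :: "'k::field"
  assumes two: "(2::'k) \<noteq> 0" and a: "a ^ 2 \<noteq> 4"
  defines "l \<equiv> (2 - a) / 4"
  shows "bij_betw (\<lambda>(x, y). ((y + x ^ 2 + 1) / 2, x * ((y + x ^ 2 + 1) / 2 - l)))
           (jacobi_affine a)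
           {(u, v). proj_pt (u, v, 1) \<in> legendre_curve l \<and> u \<noteq> l}"
    and "\<And>x y. (x, y) \<in> jacobi_affine a \<Longrightarrow>
           (let u = (y + x ^ 2 + 1) / 2; v = x * (u - l)
            in x = v / (u - l) \<and> y = 2 * u - 1 - (v / (u - l)) ^ 2)"
proof -
  have four: "(4::'k) \<noteq> 0"
    using two by (metis mult_eq_0_iff numeral_Bit0 mult_2)
  have "4 * l = 2 - a" unfolding l_def using four by (metis nonzero_mult_div_cancel_left times_divide_eq_right)
  then have al: "a = 2 - 4 * l" by (simp add: algebra_simps)
  have l01: "l \<noteq> 0" "l \<noteq> 1"
    using a al by (auto simp: power2_eq_square)
  have aff: "proj_pt (u, v, 1) \<in> legendre_curve l \<longleftrightarrow> v ^ 2 = u * (u - 1) * (u - l)" for u v :: 'k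
  proof
    assume "proj_pt (u, v, 1) \<in> legendre_curve l"
    then obtain x y z where xyz: "proj_pt (u, v, 1) = proj_pt (x, y, z)"
      and eq: "y ^ 2 * z = x * (x - z) * (x - l * z)"
      unfolding legendre_curve_def by blast
    have "(u, v, 1) \<in> proj_pt (u, v, 1)" by (auto simp: proj_pt_def intro: exI[of _ 1])
    then have "\<exists>c. u = c * x \<and> v = c * y \<and> 1 = c * z"
      unfolding xyz by (simp add: proj_pt_def) blast
    then obtain c where c: "u = c * x" "v = c * y" "1 = c * z" by blast
    have "v ^ 2 = v ^ 2 * (c * z)" using c(3) by simp
    also have "\<dots> = c ^ 3 * (y ^ 2 * z)"
      by (simp add: c(2) power2_eq_square power3_eq_cube algebra_simps)
    also have "\<dots> = u * (u - c * z) * (u - l * (c * z))"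
      unfolding eq c(1) by (simp add: power3_eq_cube algebra_simps)
    finally show "v ^ 2 = u * (u - 1) * (u - l)" using c(3) by simp
  next
    assume "v ^ 2 = u * (u - 1) * (u - l)"
    then show "proj_pt (u, v, 1) \<in> legendre_curve l"
      unfolding legendre_curve_def by force
  qed
  have key: "x ^ 4 + a * x ^ 2 + 1 - (2 * u - 1 - x ^ 2) ^ 2 = 4 * (x ^ 2 * (u - l) - u * (u - 1))"
    for x u :: 'k
    unfolding al by (simp add: power2_eq_square power4_eq_xxxx algebra_simps)
  have on_iff: "(x, 2 * u - 1 - x ^ 2) \<in> jacobi_affine a \<longleftrightarrow> x ^ 2 * (u - l) = u * (u - 1)"
    for x u
    using key[of x u] four by (auto simp: jacobi_affine_def)
  have mem: "x ^ 2 * (u - l) = u * (u - 1) \<and> u \<noteq> l"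
    if "(x, y) \<in> jacobi_affine a" "u = (y + x ^ 2 + 1) / 2" for x y u
  proof -
    have "2 * u = y + x ^ 2 + 1" using that(2) two by (simp add: mult.commute)
    then have "y = 2 * u - 1 - x ^ 2" by (simp add: algebra_simps)
    then have "x ^ 2 * (u - l) = u * (u - 1)" using that(1) on_iff by simp
    then show ?thesis using l01 by auto
  qed
  show "bij_betw (\<lambda>(x, y). ((y + x ^ 2 + 1) / 2, x * ((y + x ^ 2 + 1) / 2 - l)))
           (jacobi_affine a)
           {(u, v). proj_pt (u, v, 1) \<in> legendre_curve l \<and> u \<noteq> l}"
  proof (rule bij_betw_byWitness[where f' = "\<lambda>(u, v). (v / (u - l), 2 * u - 1 - (v / (u - l)) ^ 2)"],
      goal_cases)
    case 1
    show ?case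
    proof
      fix p assume "p \<in> jacobi_affine a"
      moreover obtain x y where p: "p = (x, y)" by (cases p)
      ultimately have xy: "(x, y) \<in> jacobi_affine a" by simp
      define u where "u = (y + x ^ 2 + 1) / 2"
      then have "u \<noteq> l" "2 * u = y + x ^ 2 + 1" using mem[OF xy u_def] two by (simp_all add: mult.commute)
      then show "(case case p of
            (x, y) \<Rightarrow> ((y + x ^ 2 + 1) / 2, x * ((y + x ^ 2 + 1) / 2 - l)) of
          (u, v) \<Rightarrow> (v / (u - l), 2 * u - 1 - (v / (u - l)) ^ 2)) = p"
        unfolding p prod.case u_def[symmetric] by simp
    qed
  next
    case 2
    show ?case using two by auto
  next
    case 3
    show ?case
    proof (rule image_subsetI)
      fix p assume "p \<in> jacobi_affine a"
      moreover obtain x y where p: "p = (x, y)" by (cases p)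
      ultimately have xy: "(x, y) \<in> jacobi_affine a" by simp
      define u where "u = (y + x ^ 2 + 1) / 2"
      have "x ^ 2 * (u - l) = u * (u - 1)" "u \<noteq> l" using mem[OF xy u_def] by auto
      moreover from this(1) have "(x * (u - l)) ^ 2 = u * (u - 1) * (u - l)"
        by (metis mult.assoc power2_eq_square power_mult_distrib)
      ultimately show "(case p of (x, y) \<Rightarrow> ((y + x ^ 2 + 1) / 2, x * ((y + x ^ 2 + 1) / 2 - l)))
          \<in> {(u, v). proj_pt (u, v, 1) \<in> legendre_curve l \<and> u \<noteq> l}"
        unfolding aff p prod.case u_def[symmetric] by blast
    qed
  next
    case 4
    show ?case
    proof (rule image_subsetI)
      fix p assume "p \<in> {(u, v). proj_pt (u, v, 1) \<in> legendre_curve l \<and> u \<noteq> l}"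
      moreover obtain u v where p: "p = (u, v)" by (cases p)
      ultimately have "proj_pt (u, v, 1) \<in> legendre_curve l" and ne: "u \<noteq> l" by auto
      then have "v ^ 2 = u * (u - 1) * (u - l)" by (simp add: aff)
      moreover have "(v / (u - l)) ^ 2 * (u - l) = v ^ 2 / (u - l)"
        using ne by (simp add: power2_eq_square)
      ultimately have "(v / (u - l)) ^ 2 * (u - l) = u * (u - 1)"
        using ne by simp
      then have "(v / (u - l), 2 * u - 1 - (v / (u - l)) ^ 2) \<in> jacobi_affine a"
        by (simp only: on_iff)
      then show "(case p of (u, v) \<Rightarrow> (v / (u - l), 2 * u - 1 - (v / (u - l)) ^ 2))
          \<in> jacobi_affine a"
        unfolding p by simp
    qed
  qed
  show "let u = (y + x ^ 2 + 1) / 2; v = x * (u - l)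
        in x = v / (u - l) \<and> y = 2 * u - 1 - (v / (u - l)) ^ 2"
    if "(x, y) \<in> jacobi_affine a" for x y
  proof -
    define u where "u = (y + x ^ 2 + 1) / 2"
    then have "u \<noteq> l" "2 * u = y + x ^ 2 + 1" using mem[OF that u_def] two by (simp_all add: mult.commute)
    then show ?thesis unfolding u_def[symmetric] Let_def by simp
  qed
qed

text \<open>
  The Jacobi quartic curves over the finite field \<^typ>\<open>'q\<close>, represented by their parameter \<open>a\<close>,
  and isomorphism of the corresponding elliptic curves over the algebraic closure.
\<close>

definition jacobi_params :: "'q::{field, finite} set" where
  "jacobi_params = {a. a ^ 2 \<noteq> 4}"

definition jacobi_iso :: "('q::{field, finite} \<times> 'q) set" where
  "jacobi_iso = {(a, b). a \<in> jacobi_params \<and> b \<in> jacobi_params \<and>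
     elliptic_iso (jacobi_elliptic (to_ac a)) (jacobi_elliptic (to_ac b))}"

end

theory Submission
  imports Defs
begin

text \<open>
  Under \<open>l = (2 - a) / 4\<close> the curves correspond to the Legendre curves \<open>y\<^sup>2 = x (x - 1) (x - l)\<close> with \<open>l\<close>
  in the finite field and \<open>l \<notin> {0, 1}\<close>. Those for \<open>l\<close> and \<open>m\<close> are isomorphic over the algebraic closure iff
  \<open>m\<close> is one of \<open>l, 1 - l, 1 / l, 1 - 1 / l, 1 / (1 - l), l / (l - 1)\<close> (\<open>elliptic_iso_legendre_iff\<close>).
  Thus isomorphism classes are orbits of the anharmonic group of order six on the \<open>q - 2\<close> parameters, and
  they can be counted directly (\<open>count_anharmonic_orbits\<close>): all orbits have six elements, except for
  \<open>{-1, 2, 1/2}\<close> and the set of roots of \<open>t\<^sup>2 - t + 1\<close>, which has two elements or none.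

  That isomorphic curves have parameters in the same orbit is the substantial part. An isomorphism maps
  the affine parts to each other, so it is given by two functions \<open>U\<close>, \<open>V\<close> on the affine curve that are
  locally quotients of polynomials. Such functions are polynomials, of the form \<open>A(x) + B(x) y\<close>
  (\<open>locally_regular_imp_regular\<close>). Their pole order at infinity is the degree of the norm \<open>A\<^sup>2 - B\<^sup>2 g\<close>,
  where \<open>g\<close> is the cubic; it is additive on products and takes distinct values on nonzero \<open>A\<close> and \<open>B y\<close>.
  Comparing pole orders in \<open>V\<^sup>2 = g(U)\<close> and in the expressions of \<open>x\<close>, \<open>y\<close> through \<open>U\<close>, \<open>V\<close> shows that
  \<open>U = \<alpha> x + \<beta>\<close> and \<open>V = \<gamma> y\<close> (\<open>affine_iso_imp_linear\<close>). So an affine map of the line carries the roots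
  \<open>0, 1, l\<close> of one cubic to the roots \<open>0, 1, m\<close> of the other, which leaves six values for \<open>m\<close>.
\<close>

section \<open>Regular functions on the affine curve and their poles\<close>

definition on_legendre :: "'k::field \<Rightarrow> 'k \<Rightarrow> 'k \<Rightarrow> bool" where
  "on_legendre l x y \<longleftrightarrow> y ^ 2 = x * (x - 1) * (x - l)"

definition legendre_cubic :: "'k::field \<Rightarrow> 'k poly" where
  "legendre_cubic l = [:0, 1:] * [:-1, 1:] * [:-l, 1:]"

text \<open>
  The coordinate ring of the affine curve is \<open>K[x] \<oplus> K[x] y\<close>; this is the norm of \<open>A + B y\<close>
  over \<open>K[x]\<close>, i.e. the product with its conjugate \<open>A - B y\<close>.
\<close>

definition legendre_norm :: "'k::field \<Rightarrow> 'k poly \<Rightarrow> 'k poly \<Rightarrow> 'k poly" where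
  "legendre_norm l A B = A ^ 2 - B ^ 2 * legendre_cubic l"

definition represents :: "'k::field \<Rightarrow> 'k poly \<Rightarrow> 'k poly \<Rightarrow> ('k \<Rightarrow> 'k \<Rightarrow> 'k) \<Rightarrow> bool" where
  "represents l A B F \<longleftrightarrow> (\<forall>x y. on_legendre l x y \<longrightarrow> F x y = poly A x + poly B x * y)"

definition regular_fun :: "'k::field \<Rightarrow> ('k \<Rightarrow> 'k \<Rightarrow> 'k) \<Rightarrow> bool" where
  "regular_fun l F \<longleftrightarrow> (\<exists>A B. represents l A B F)"

text \<open>
  The degree of the norm is the order of the pole at the point at infinity: the norm has the poles
  of \<open>F\<close> and of its conjugate, which agree since the point at infinity is fixed by \<open>y \<mapsto> -y\<close>, and
  \<open>x\<close> has a double pole there. It is a relation, as the zero function has no order.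
\<close>

definition has_pole_order :: "'k::field \<Rightarrow> ('k \<Rightarrow> 'k \<Rightarrow> 'k) \<Rightarrow> nat \<Rightarrow> bool" where
  "has_pole_order l F n \<longleftrightarrow> (\<exists>A B. represents l A B F \<and> legendre_norm l A B \<noteq> 0 \<and>
     Polynomial.degree (legendre_norm l A B) = n)"

lemma poly_legendre_cubic: "poly (legendre_cubic l) x = x * (x - 1) * (x - l)"
  by (simp add: legendre_cubic_def algebra_simps)

lemma degree_legendre_cubic: "Polynomial.degree (legendre_cubic l) = 3"
  by (simp add: legendre_cubic_def degree_mult_eq)

lemma legendre_cubic_nonzero: "legendre_cubic l \<noteq> 0"
  using degree_legendre_cubic[of l] by auto

lemma degree_square_times_cubic:
  "B \<noteq> 0 \<Longrightarrow> Polynomial.degree (B ^ 2 * legendre_cubic l) = 2 * Polynomial.degree B + 3"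
  by (simp add: degree_mult_eq degree_power_eq legendre_cubic_nonzero degree_legendre_cubic)

text \<open>
  The degrees of \<open>A\<^sup>2\<close> and \<open>B\<^sup>2 g\<close> (with \<open>g\<close> the cubic) have different parity, so nothing cancels.
\<close>

lemma degree_legendre_norm:
  "Polynomial.degree (legendre_norm l A B) =
     max (2 * Polynomial.degree A) (if B = 0 then 0 else 2 * Polynomial.degree B + 3)"
proof (cases "B = 0")
  case True
  then show ?thesis by (cases "A = 0") (auto simp: legendre_norm_def degree_power_eq)
next
  case B: False
  have dA: "Polynomial.degree (A ^ 2) = 2 * Polynomial.degree A"
    by (cases "A = 0") (auto simp: degree_power_eq)
  have "2 * Polynomial.degree A \<noteq> 2 * Polynomial.degree B + 3" by presburger
  then consider "Polynomial.degree (A ^ 2) < Polynomial.degree (- (B ^ 2 * legendre_cubic l))"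
    | "Polynomial.degree (- (B ^ 2 * legendre_cubic l)) < Polynomial.degree (A ^ 2)"
    unfolding dA degree_minus degree_square_times_cubic[OF B] by linarith
  then show ?thesis
  proof cases
    case 1
    then have "Polynomial.degree (A ^ 2 + (- (B ^ 2 * legendre_cubic l))) = 2 * Polynomial.degree B + 3"
      using degree_square_times_cubic[OF B] by (simp only: degree_add_eq_right degree_minus)
    with 1 B show ?thesis
      unfolding dA degree_minus degree_square_times_cubic[OF B] by (simp add: legendre_norm_def)
  next
    case 2
    then have "Polynomial.degree (A ^ 2 + (- (B ^ 2 * legendre_cubic l))) = 2 * Polynomial.degree A"
      using dA by (simp only: degree_add_eq_left)
    with 2 B show ?thesis
      unfolding dA degree_minus degree_square_times_cubic[OF B] by (simp add: legendre_norm_def)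
  qed
qed

lemma legendre_norm_eq_0_iff: "legendre_norm l A B = 0 \<longleftrightarrow> A = 0 \<and> B = 0"
proof
  assume N: "legendre_norm l A B = 0"
  have "B = 0"
    using degree_legendre_norm[of l A B] N by (auto split: if_splits)
  then show "A = 0 \<and> B = 0" using N by (simp add: legendre_norm_def)
qed (simp add: legendre_norm_def)

lemma poly_legendre_norm:
  assumes "on_legendre l x y"
  shows "poly (legendre_norm l A B) x = (poly A x + poly B x * y) * (poly A x - poly B x * y)"
proof -
  have "poly (legendre_norm l A B) x = (poly A x) ^ 2 - (poly B x) ^ 2 * y ^ 2"
    using assms by (simp add: legendre_norm_def poly_legendre_cubic on_legendre_def)
  then show ?thesis by (simp add: power2_eq_square algebra_simps)
qed

lemma poly_zero_if_vanishes:
  fixes p :: "'k::alg_closed_field poly"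
  assumes "\<And>x. poly p x = 0"
  shows "p = 0"
proof (rule ccontr)
  assume "p \<noteq> 0"
  then have "Polynomial.degree p > 0"
    using assms by (metis degree_0_id gr0I pCons_0_0 poly_const_conv)
  then have "Polynomial.degree (p + 1) > 0"
    by (simp add: degree_add_eq_left)
  then obtain x where "poly (p + 1) x = 0" using alg_closed_imp_poly_has_root by blast
  then show False using assms by simp
qed

lemma on_legendre_exists:
  obtains y where "on_legendre (l :: 'k::alg_closed_field) x y"
  unfolding on_legendre_def using nth_root_exists[of 2 "x * (x - 1) * (x - l)"] by auto

text \<open>
  A function vanishing on the curve has a norm vanishing on the whole line, and the parity argument
  shows that only \<open>0\<close> has norm \<open>0\<close>. Hence the coefficients \<open>A\<close> and \<open>B\<close> of a regular function,
  and with them its pole order, are well defined.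
\<close>

lemma represents_zero_unique:
  fixes l :: "'k::alg_closed_field"
  assumes "represents l A B (\<lambda>x y. 0)"
  shows "A = 0" and "B = 0"
proof -
  have "poly (legendre_norm l A B) x = 0" for x
  proof -
    obtain y where y: "on_legendre l x y" by (rule on_legendre_exists)
    then show ?thesis
      using assms poly_legendre_norm[OF y] unfolding represents_def by simp
  qed
  then show "A = 0" "B = 0"
    using poly_zero_if_vanishes legendre_norm_eq_0_iff by blast+
qed

lemma represents_unique:
  fixes l :: "'k::alg_closed_field"
  assumes "represents l A B F" "represents l C D F"
  shows "A = C" and "B = D"
proof -
  have "represents l (A - C) (B - D) (\<lambda>x y. 0)"
    using assms unfolding represents_def by (auto simp: algebra_simps)
  then show "A = C" "B = D"
    using represents_zero_unique by fastforce+
qed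

lemma represents_const: "represents l [:c:] 0 (\<lambda>x y. c)"
  and represents_x: "represents l [:0, 1:] 0 (\<lambda>x y. x)"
  and represents_y: "represents l 0 1 (\<lambda>x y. y)"
  by (simp_all add: represents_def)

lemma represents_add:
  "represents l A B F \<Longrightarrow> represents l C D G \<Longrightarrow> represents l (A + C) (B + D) (\<lambda>x y. F x y + G x y)"
  by (simp add: represents_def algebra_simps)

lemma represents_mult:
  assumes "represents l A B F" "represents l C D G"
  shows "represents l (A * C + B * D * legendre_cubic l) (A * D + B * C) (\<lambda>x y. F x y * G x y)"
  unfolding represents_def
proof (intro allI impI)
  fix x y assume xy: "on_legendre l x y"
  have "poly (B * D * legendre_cubic l) x = poly B x * poly D x * y ^ 2"
    using xy by (simp add: poly_legendre_cubic on_legendre_def)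
  then show "F x y * G x y =
      poly (A * C + B * D * legendre_cubic l) x + poly (A * D + B * C) x * y"
    using assms xy unfolding represents_def by (auto simp: power2_eq_square algebra_simps)
qed

lemma legendre_norm_mult:
  "legendre_norm l (A * C + B * D * legendre_cubic l) (A * D + B * C) =
     legendre_norm l A B * legendre_norm l C D"
  by (simp add: legendre_norm_def power2_eq_square algebra_simps)

lemma regular_fun_const: "regular_fun l (\<lambda>x y. c)"
  and regular_fun_x: "regular_fun l (\<lambda>x y. x)"
  and regular_fun_y: "regular_fun l (\<lambda>x y. y)"
  unfolding regular_fun_def using represents_const represents_x represents_y by blast+

lemma regular_fun_add: "regular_fun l F \<Longrightarrow> regular_fun l G \<Longrightarrow> regular_fun l (\<lambda>x y. F x y + G x y)"
  unfolding regular_fun_def using represents_add by blast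

lemma regular_fun_mult: "regular_fun l F \<Longrightarrow> regular_fun l G \<Longrightarrow> regular_fun l (\<lambda>x y. F x y * G x y)"
  unfolding regular_fun_def using represents_mult by blast

lemma regular_fun_power: "regular_fun l F \<Longrightarrow> regular_fun l (\<lambda>x y. F x y ^ n)"
  by (induction n) (simp_all add: regular_fun_const regular_fun_mult)

lemma regular_fun_sum:
  "(\<And>i. i \<in> I \<Longrightarrow> regular_fun l (F i)) \<Longrightarrow> regular_fun l (\<lambda>x y. \<Sum>i\<in>I. F i x y)"
  by (induction I rule: infinite_finite_induct) (simp_all add: regular_fun_const regular_fun_add)

lemma regular_fun_poly: "regular_fun l (\<lambda>x y. poly p x)"
  unfolding regular_fun_def represents_def by (intro exI[of _ p] exI[of _ 0]) simp

lemma regular_fun_cong: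
  "regular_fun l F \<Longrightarrow> (\<And>x y. on_legendre l x y \<Longrightarrow> F x y = G x y) \<Longrightarrow> regular_fun l G"
  unfolding regular_fun_def represents_def by metis

lemma pole_order_cong:
  "has_pole_order l F n \<Longrightarrow> (\<And>x y. on_legendre l x y \<Longrightarrow> F x y = G x y) \<Longrightarrow> has_pole_order l G n"
  unfolding has_pole_order_def represents_def by metis

lemma pole_order_unique:
  fixes l :: "'k::alg_closed_field"
  shows "has_pole_order l F m \<Longrightarrow> has_pole_order l F n \<Longrightarrow> m = n"
  unfolding has_pole_order_def using represents_unique by metis

lemma not_pole_order_zero:
  fixes l :: "'k::alg_closed_field"
  shows "\<not> has_pole_order l (\<lambda>x y. 0) n"
  unfolding has_pole_order_def using represents_zero_unique legendre_norm_eq_0_iff by metis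

lemma regular_fun_cases:
  assumes "regular_fun l F"
  obtains (zero) "\<And>x y. on_legendre l x y \<Longrightarrow> F x y = 0" | (order) n where "has_pole_order l F n"
proof -
  obtain A B where AB: "represents l A B F" using assms unfolding regular_fun_def by blast
  show ?thesis
  proof (cases "legendre_norm l A B = 0")
    case True
    then show ?thesis using AB zero legendre_norm_eq_0_iff[of l A B] by (auto simp: represents_def)
  next
    case False
    then show ?thesis using AB order unfolding has_pole_order_def by blast
  qed
qed

lemma pole_order_const: "c \<noteq> 0 \<Longrightarrow> has_pole_order l (\<lambda>x y. c) 0"
  unfolding has_pole_order_def using represents_const[of l c]
  by (intro exI[of _ "[:c:]"] exI[of _ 0]) (simp add: legendre_norm_def power2_eq_square)

lemma pole_order_x: "has_pole_order l (\<lambda>x y. x) 2"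
  unfolding has_pole_order_def using represents_x[of l] degree_legendre_norm[of l "[:0,1:]" 0]
  by (intro exI[of _ "[:0, 1:]"] exI[of _ 0]) (simp add: legendre_norm_eq_0_iff)

lemma pole_order_y: "has_pole_order l (\<lambda>x y. y) 3"
  unfolding has_pole_order_def using represents_y[of l] degree_legendre_norm[of l 0 1]
  by (intro exI[of _ 0] exI[of _ 1]) (simp add: legendre_norm_eq_0_iff)

lemma pole_order_mult:
  assumes "has_pole_order l F m" "has_pole_order l G n"
  shows "has_pole_order l (\<lambda>x y. F x y * G x y) (m + n)"
proof -
  obtain A B C D where AB: "represents l A B F" "legendre_norm l A B \<noteq> 0"
      "Polynomial.degree (legendre_norm l A B) = m"
    and CD: "represents l C D G" "legendre_norm l C D \<noteq> 0"
      "Polynomial.degree (legendre_norm l C D) = n"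
    using assms unfolding has_pole_order_def by blast
  show ?thesis
    unfolding has_pole_order_def
    using represents_mult[OF AB(1) CD(1)] AB CD
    by (intro exI[of _ "A * C + B * D * legendre_cubic l"] exI[of _ "A * D + B * C"])
       (auto simp: legendre_norm_mult degree_mult_eq)
qed

lemma degree_legendre_norm_le_iff:
  "Polynomial.degree (legendre_norm l A B) \<le> n \<longleftrightarrow>
     2 * Polynomial.degree A \<le> n \<and> (B = 0 \<or> 2 * Polynomial.degree B + 3 \<le> n)"
  by (auto simp: degree_legendre_norm)

lemma degree_legendre_norm_diff_le:
  assumes "Polynomial.degree (legendre_norm l A B) \<le> n" "Polynomial.degree (legendre_norm l C D) \<le> n"
  shows "Polynomial.degree (legendre_norm l (A - C) (B - D)) \<le> n"
proof -
  have "Polynomial.degree (A - C) \<le> max (Polynomial.degree A) (Polynomial.degree C)"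
       "Polynomial.degree (B - D) \<le> max (Polynomial.degree B) (Polynomial.degree D)"
    by (rule degree_diff_le_max)+
  then show ?thesis
    using assms unfolding degree_legendre_norm_le_iff
    by (cases "B = 0"; cases "D = 0") (auto simp: max_def split: if_splits)
qed

text \<open>
  If the sum had order below \<open>n\<close>, then so would \<open>G\<close>, the sum minus \<open>F\<close>.
\<close>

lemma pole_order_add:
  assumes "has_pole_order l F m" "has_pole_order l G n" "m < n"
  shows "has_pole_order l (\<lambda>x y. F x y + G x y) n"
proof -
  obtain A B C D where AB: "represents l A B F" "Polynomial.degree (legendre_norm l A B) = m"
    and CD: "represents l C D G" "Polynomial.degree (legendre_norm l C D) = n"
    using assms unfolding has_pole_order_def by blast
  have mAB: "Polynomial.degree (legendre_norm l (- A) (- B)) = m"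
    using AB(2) by (simp add: degree_legendre_norm cong: if_cong)
  have "Polynomial.degree (legendre_norm l (C - (- A)) (D - (- B))) \<le> n"
    by (rule degree_legendre_norm_diff_le) (use mAB CD assms(3) in auto)
  moreover have "\<not> Polynomial.degree (legendre_norm l (A + C) (B + D)) \<le> n - 1"
  proof
    assume "Polynomial.degree (legendre_norm l (A + C) (B + D)) \<le> n - 1"
    then have "Polynomial.degree (legendre_norm l ((A + C) - A) ((B + D) - B)) \<le> n - 1"
      by (rule degree_legendre_norm_diff_le) (use AB assms(3) in auto)
    then show False using CD assms(3) by simp
  qed
  ultimately have "Polynomial.degree (legendre_norm l (A + C) (B + D)) = n"
    by (simp add: add.commute)
  then show ?thesis
    unfolding has_pole_order_def using represents_add[OF AB(1) CD(1)] assms(3) by fastforce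
qed

lemma pole_order_poly:
  assumes "has_pole_order l U n" "n > 0" "p \<noteq> 0"
  shows "has_pole_order l (\<lambda>x y. poly p (U x y)) (n * Polynomial.degree p)"
  using assms(3)
proof (induction p)
  case (pCons c p)
  show ?case
  proof (cases "p = 0")
    case True
    then show ?thesis using pCons pole_order_const[of c l] by simp
  next
    case False
    then have *: "has_pole_order l (\<lambda>x y. U x y * poly p (U x y)) (n + n * Polynomial.degree p)"
      using pCons.IH assms(1) pole_order_mult by blast
    show ?thesis
    proof (cases "c = 0")
      case True
      then show ?thesis using * False by simp
    next
      case c: False
      then show ?thesis
        using pole_order_add[OF pole_order_const[OF c] *] assms(2) False by simp
    qed
  qed
qed simp

section \<open>Locally regular functions are polynomial\<close>

text \<open>
  The Nullstellensatz in one variable: \<open>J\<close> is a principal ideal, and a nonconstant generator would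
  have a root common to all members of \<open>J\<close>.
\<close>

lemma poly_ideal_unit:
  fixes J :: "'k::alg_closed_field poly set"
  assumes add: "\<And>p q. p \<in> J \<Longrightarrow> q \<in> J \<Longrightarrow> p + q \<in> J"
    and mult: "\<And>p q. p \<in> J \<Longrightarrow> q * p \<in> J"
    and no_zero: "\<And>x. \<exists>p\<in>J. poly p x \<noteq> 0"
  shows "1 \<in> J"
proof -
  have "\<exists>p. p \<in> J \<and> p \<noteq> 0" using no_zero[of 0] by auto
  then obtain p where p: "p \<in> J" "p \<noteq> 0"
    and least: "\<And>q. q \<in> J \<Longrightarrow> q \<noteq> 0 \<Longrightarrow> Polynomial.degree p \<le> Polynomial.degree q"
    using ex_has_least_nat[of "\<lambda>p. p \<in> J \<and> p \<noteq> 0" _ Polynomial.degree] by blast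
  have dvd: "p dvd q" if "q \<in> J" for q
  proof (rule ccontr)
    assume "\<not> p dvd q"
    then have nz: "q mod p \<noteq> 0" by (simp add: dvd_eq_mod_eq_0)
    have "q mod p = q + (- (q div p)) * p" by (simp add: minus_div_mult_eq_mod)
    then have "q mod p \<in> J" using add[OF that mult[OF p(1), of "- (q div p)"]] by (simp only:)
    then show False using least[OF _ nz] degree_mod_less'[OF p(2) nz] by simp
  qed
  have "Polynomial.degree p = 0"
  proof (rule ccontr)
    assume "Polynomial.degree p \<noteq> 0"
    then obtain x where "poly p x = 0" using alg_closed_imp_poly_has_root by blast
    moreover obtain q where "q \<in> J" "poly q x \<noteq> 0" using no_zero by blast
    ultimately show False using dvd by fastforce
  qed
  then obtain c where c: "p = [:c:]" by (rule degree_eq_zeroE)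
  then have "[:inverse c:] * p = 1" using p(2) by simp
  then show ?thesis using mult[OF p(1)] by metis
qed

text \<open>
  The denominators \<open>h\<close> for which \<open>h U\<close> is regular form an ideal without common zero on the curve, and
  \<open>1\<close> has to be shown to belong to it. Taking norms reduces this to the ideal of denominators in
  \<open>K[x]\<close>, where the previous lemma applies. The norm of \<open>h\<close> at \<open>x\<close> is the product of the values of
  \<open>h\<close> at \<open>(x, y)\<close> and \<open>(x, -y)\<close>, so a single denominator that vanishes at neither point is needed.
\<close>

lemma locally_regular_imp_regular:
  fixes l :: "'k::alg_closed_field"
  assumes loc: "\<And>x y. on_legendre l x y \<Longrightarrow> \<exists>h n. regular_fun l h \<and> regular_fun l n \<and> h x y \<noteq> 0 \<and>
     (\<forall>x' y'. on_legendre l x' y' \<longrightarrow> h x' y' * U x' y' = n x' y')"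
  shows "regular_fun l U"
proof -
  define I where "I = {h. regular_fun l h \<and> regular_fun l (\<lambda>x y. h x y * U x y)}"
  have I_mult: "(\<lambda>x y. r x y * h x y) \<in> I" if "regular_fun l r" "h \<in> I" for r h
    using that regular_fun_mult[of l r h] regular_fun_mult[of l r "\<lambda>x y. h x y * U x y"]
    by (simp add: I_def mult.assoc)
  have I_add: "(\<lambda>x y. h x y + h' x y) \<in> I" if "h \<in> I" "h' \<in> I" for h h'
    using that regular_fun_add[of l h h']
      regular_fun_add[of l "\<lambda>x y. h x y * U x y" "\<lambda>x y. h' x y * U x y"]
    by (simp add: I_def algebra_simps)
  have I_point: "\<exists>h\<in>I. h x y \<noteq> 0" if xy: "on_legendre l x y" for x y
  proof -
    obtain h n where h: "regular_fun l h" "regular_fun l n" "h x y \<noteq> 0"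
       "\<And>x' y'. on_legendre l x' y' \<Longrightarrow> h x' y' * U x' y' = n x' y'"
      using loc[OF xy] by blast
    have "regular_fun l (\<lambda>x y. h x y * U x y)"
      by (rule regular_fun_cong[OF h(2)]) (simp add: h(4))
    then show ?thesis using h(1,3) unfolding I_def by blast
  qed
  define J where "J = {p. (\<lambda>x y. poly p x) \<in> I}"
  have "1 \<in> J"
  proof (rule poly_ideal_unit)
    show "p + q \<in> J" if "p \<in> J" "q \<in> J" for p q
      using that I_add unfolding J_def by fastforce
    show "q * p \<in> J" if "p \<in> J" for p q
      using that I_mult[OF regular_fun_poly] unfolding J_def by fastforce
    show "\<exists>p\<in>J. poly p x \<noteq> 0" for x
    proof -
      obtain y where y: "on_legendre l x y" by (rule on_legendre_exists)
      then have y': "on_legendre l x (- y)" by (simp add: on_legendre_def)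
      obtain h1 h2 where h1: "h1 \<in> I" "h1 x y \<noteq> 0" and h2: "h2 \<in> I" "h2 x (- y) \<noteq> 0"
        using I_point[OF y] I_point[OF y'] by blast
      obtain h where h: "h \<in> I" "h x y \<noteq> 0" "h x (- y) \<noteq> 0"
      \<comment> \<open>If each of the two vanishes at the other's point, their sum vanishes at neither.\<close>
      proof (cases "h1 x (- y) = 0 \<and> h2 x y = 0")
        case True
        then show ?thesis using that[OF I_add[OF h1(1) h2(1)]] h1 h2 by simp
      next
        case False
        then show ?thesis using that h1 h2 by blast
      qed
      obtain A B where AB: "represents l A B h"
        using h(1) unfolding I_def regular_fun_def by blast
      have "poly (legendre_norm l A B) x \<noteq> 0"
        using h AB y y' unfolding poly_legendre_norm[OF y] represents_def by fastforce
      moreover have "legendre_norm l A B \<in> J"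
      proof -
        define hc where "hc = (\<lambda>x y. poly A x - poly B x * y)"
        have "represents l A (- B) hc" by (simp add: represents_def hc_def)
        then have "regular_fun l hc" unfolding regular_fun_def by blast
        then have m: "(\<lambda>x y. hc x y * h x y) \<in> I" using I_mult h(1) by blast
        have eq: "hc x y * h x y = poly (legendre_norm l A B) x" if "on_legendre l x y" for x y
          using AB that by (simp add: represents_def hc_def poly_legendre_norm mult.commute)
        have "regular_fun l (\<lambda>x y. poly (legendre_norm l A B) x * U x y)"
          by (rule regular_fun_cong[of l "\<lambda>x y. (hc x y * h x y) * U x y"])
             (use m eq in \<open>auto simp: I_def\<close>)
        then show ?thesis by (simp add: J_def I_def regular_fun_poly)
      qed
      ultimately show ?thesis by blast
    qed
  qed
  then show ?thesis by (simp add: J_def I_def)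
qed

section \<open>Isomorphisms of the affine curves are linear\<close>

text \<open>
  From \<open>V\<^sup>2 = g(U)\<close> with \<open>g\<close> a cubic, the pole orders of \<open>U\<close> and \<open>V\<close> are \<open>2 k\<close> and \<open>3 k\<close> for some \<open>k\<close>,
  and then \<open>k\<close> divides the pole order of every nonzero polynomial in \<open>U\<close> and \<open>V\<close>. By means of the inverse map
  \<open>x\<close> and \<open>y\<close> are such polynomials; they have orders \<open>2\<close> and \<open>3\<close>, so \<open>k = 1\<close>. This is what
  the inverse is for: in characteristic \<open>p\<close>, Frobenius is a bijective morphism with \<open>k = p\<close>.
  The functions of pole order \<open>2\<close> are the \<open>\<alpha> x + \<beta>\<close> with \<open>\<alpha> \<noteq> 0\<close>, and \<open>V = \<gamma> y + C(x)\<close> with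
  \<open>\<gamma> \<noteq> 0\<close>. Since \<open>V\<^sup>2\<close> is a polynomial in \<open>x\<close>, the cross term \<open>2 \<gamma> C y\<close> vanishes.
\<close>

lemma affine_iso_imp_linear:
  fixes l m :: "'k::alg_closed_field"
  assumes two: "(2::'k) \<noteq> 0"
    and U: "regular_fun l U" and V: "regular_fun l V"
    and U': "regular_fun m U'" and V': "regular_fun m V'"
    and into: "\<And>x y. on_legendre l x y \<Longrightarrow> on_legendre m (U x y) (V x y)"
    and inv_x: "\<And>x y. on_legendre l x y \<Longrightarrow> U' (U x y) (V x y) = x"
    and inv_y: "\<And>x y. on_legendre l x y \<Longrightarrow> V' (U x y) (V x y) = y"
    and nonconst: "on_legendre l x0 y0" "on_legendre l x1 y1" "U x0 y0 \<noteq> U x1 y1"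
  shows "\<exists>\<alpha> \<beta> \<gamma>. \<alpha> \<noteq> 0 \<and> \<gamma> \<noteq> 0 \<and>
    (\<forall>x. (\<alpha> * x + \<beta>) * (\<alpha> * x + \<beta> - 1) * (\<alpha> * x + \<beta> - m) = \<gamma> ^ 2 * (x * (x - 1) * (x - l)))"
proof -
  obtain n where n: "has_pole_order l U n"
  proof (cases rule: regular_fun_cases[OF U])
    case 1
    then show ?thesis using nonconst by simp
  qed (use that in blast)
  have "n > 0"
  proof (rule ccontr)
    assume "\<not> n > 0"
    then obtain A B where AB: "represents l A B U" "Polynomial.degree (legendre_norm l A B) \<le> 0"
      using n unfolding has_pole_order_def by auto
    then have "B = 0" "Polynomial.degree A = 0" unfolding degree_legendre_norm_le_iff by auto
    then show False using AB(1) nonconst by (auto simp: represents_def elim!: degree_eq_zeroE)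
  qed
  have VV: "V x y * V x y = poly (legendre_cubic m) (U x y)" if "on_legendre l x y" for x y
    using into[OF that] by (simp add: on_legendre_def poly_legendre_cubic power2_eq_square)
  have gU: "has_pole_order l (\<lambda>x y. poly (legendre_cubic m) (U x y)) (n * 3)"
    using pole_order_poly[OF n \<open>n > 0\<close> legendre_cubic_nonzero[of m]] by (simp add: degree_legendre_cubic)
  have V2: "has_pole_order l (\<lambda>x y. V x y * V x y) (n * 3)"
    by (rule pole_order_cong[OF gU]) (simp add: VV)
  obtain s where s: "has_pole_order l V s"
  proof (cases rule: regular_fun_cases[OF V])
    case 1
    then have "has_pole_order l (\<lambda>x y. 0) (n * 3)" using pole_order_cong[OF V2] by fastforce
    then show ?thesis using not_pole_order_zero by blast
  qed (use that in blast)
  have "s + s = n * 3"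
    using pole_order_unique[OF pole_order_mult[OF s s] V2] .
  then have "even n" by presburger
  then obtain k where "n = 2 * k" by (rule evenE)
  with \<open>s + s = n * 3\<close> have k: "n = 2 * k" "s = 3 * k" by simp_all
  \<comment> \<open>The summands of \<open>A(U) + B(U) V\<close> have orders \<open>2 k deg A\<close> and \<open>k (2 deg B + 3)\<close>, which differ;
  hence the order of the sum is one of the two.\<close>
  have order_dvd: "k dvd r" if F: "regular_fun m F" and r: "has_pole_order l (\<lambda>x y. F (U x y) (V x y)) r" for F r
  proof -
    obtain A B where "represents m A B F" using F unfolding regular_fun_def by blast
    then have eq: "F (U x y) (V x y) = poly A (U x y) + poly B (U x y) * V x y"
      if "on_legendre l x y" for x y
      using into[OF that] by (simp add: represents_def)
    have r': "has_pole_order l (\<lambda>x y. poly A (U x y) + poly B (U x y) * V x y) r"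
      by (rule pole_order_cong[OF r]) (simp add: eq)
    note pA = pole_order_poly[OF n \<open>n > 0\<close>, of A]
    have pB: "has_pole_order l (\<lambda>x y. poly B (U x y) * V x y) (n * Polynomial.degree B + s)" if "B \<noteq> 0"
      using pole_order_mult[OF pole_order_poly[OF n \<open>n > 0\<close> that] s] .
    consider "A = 0" "B = 0" | "A \<noteq> 0" "B = 0" | "A = 0" "B \<noteq> 0" | "A \<noteq> 0" "B \<noteq> 0" by blast
    then show ?thesis
    proof cases
      case 1
      then show ?thesis using r' not_pole_order_zero[of l r] by simp
    next
      case 2
      then have "r = n * Polynomial.degree A" using r' pA pole_order_unique by fastforce
      then show ?thesis by (simp add: k)
    next
      case 3
      then have "r = n * Polynomial.degree B + s" using r' pB pole_order_unique by fastforce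
      then show ?thesis by (simp add: k)
    next
      case 4
      have "2 * Polynomial.degree A \<noteq> 2 * Polynomial.degree B + 3" by presburger
      then have "k * (2 * Polynomial.degree A) \<noteq> k * (2 * Polynomial.degree B + 3)"
        using k \<open>n > 0\<close> by auto
      then have "n * Polynomial.degree A \<noteq> n * Polynomial.degree B + s"
        by (simp add: k algebra_simps)
      then consider "n * Polynomial.degree A < n * Polynomial.degree B + s"
        | "n * Polynomial.degree B + s < n * Polynomial.degree A" by linarith
      then have "r = n * Polynomial.degree B + s \<or> r = n * Polynomial.degree A"
      proof cases
        case 1
        show ?thesis
          using pole_order_unique[OF r' pole_order_add[OF pA[OF 4(1)] pB[OF 4(2)] 1]] by simp
      next
        case 2
        show ?thesis
          using pole_order_unique[OF r'] pole_order_add[OF pB[OF 4(2)] pA[OF 4(1)] 2]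
          by (simp add: add.commute)
      qed
      then show ?thesis by (auto simp: k)
    qed
  qed
  have "k dvd 2" 
    by (rule order_dvd[OF U'], rule pole_order_cong[OF pole_order_x]) (simp add: inv_x)
  moreover have "k dvd 3" 
    by (rule order_dvd[OF V'], rule pole_order_cong[OF pole_order_y]) (simp add: inv_y)
  ultimately have "k dvd 3 - 2" by (rule dvd_diff_nat[rotated])
  then have "k = 1" by simp
  obtain A B where AB: "represents l A B U" "Polynomial.degree (legendre_norm l A B) = 2"
    using n k \<open>k = 1\<close> unfolding has_pole_order_def by auto
  then have B: "B = 0" and A: "Polynomial.degree A = 1"
    unfolding degree_legendre_norm by (auto split: if_splits simp: max_def)
  obtain C D where CD: "represents l C D V" "Polynomial.degree (legendre_norm l C D) = 3"
    using s k \<open>k = 1\<close> unfolding has_pole_order_def by auto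
  moreover have "2 * Polynomial.degree C \<noteq> 3" by presburger
  ultimately have D: "D \<noteq> 0" "Polynomial.degree D = 0"
    unfolding degree_legendre_norm by (auto split: if_splits simp: max_def)
  from A obtain \<beta> \<alpha> where A: "A = [:\<beta>, \<alpha>:]" "\<alpha> \<noteq> 0"
    by (cases A) (auto split: if_splits elim!: degree_eq_zeroE)
  from D obtain \<gamma> where D: "D = [:\<gamma>:]" "\<gamma> \<noteq> 0" by (auto elim: degree_eq_zeroE)
  have VV': "represents l (C * C + D * D * legendre_cubic l) (C * D + D * C) (\<lambda>x y. V x y * V x y)"
    by (rule represents_mult[OF CD(1) CD(1)])
  have gA: "represents l (pcompose (legendre_cubic m) A) 0 (\<lambda>x y. V x y * V x y)"
    using AB(1) VV by (simp add: represents_def poly_pcompose B)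
  have CD0: "C * D + D * C = 0" and gA': "C * C + D * D * legendre_cubic l = pcompose (legendre_cubic m) A"
    using represents_unique[OF VV' gA] by auto
  have "\<gamma> + \<gamma> \<noteq> 0" using two D(2) by (metis mult_2 mult_eq_0_iff)
  then have "D + D \<noteq> 0" by (simp only: D add_pCons add_0_left pCons_eq_0_iff simp_thms)
  moreover have "(D + D) * C = 0" using CD0 by (simp only: distrib_right mult.commute[of C D])
  ultimately have "C = 0" by (metis mult_eq_0_iff)
  then have gA'': "pcompose (legendre_cubic m) A = D * D * legendre_cubic l"
    using gA' by (simp only: mult_zero_left add_0_left)
  have "(\<alpha> * x + \<beta>) * (\<alpha> * x + \<beta> - 1) * (\<alpha> * x + \<beta> - m) = \<gamma> ^ 2 * (x * (x - 1) * (x - l))" for x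
  proof -
    have "poly A x = \<alpha> * x + \<beta>" by (simp add: A algebra_simps)
    then have "(\<alpha> * x + \<beta>) * (\<alpha> * x + \<beta> - 1) * (\<alpha> * x + \<beta> - m) = poly (pcompose (legendre_cubic m) A) x"
      by (simp only: poly_pcompose poly_legendre_cubic)
    also have "\<dots> = \<gamma> * \<gamma> * (x * (x - 1) * (x - l))"
      unfolding gA'' poly_mult poly_legendre_cubic by (simp add: D)
    finally show ?thesis by (simp only: power2_eq_square)
  qed
  then show ?thesis using A(2) D(2) by blast
qed

section \<open>From projective morphisms to regular functions\<close>
lemma proj_pt_self: "v \<in> proj_pt v"
  by (cases v) (auto simp: proj_pt_def intro: exI[of _ 1])

lemma proj_pt_scale:
  assumes "c \<noteq> 0"
  shows "proj_pt (c * x, c * y, c * z) = proj_pt (x, y, z)"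
proof -
  have "\<exists>d. d \<noteq> 0 \<and> k * x = d * (c * x) \<and> k * y = d * (c * y) \<and> k * z = d * (c * z)" if "k \<noteq> 0" for k
    using assms that by (intro exI[of _ "k / c"]) simp
  moreover have "\<exists>d. d \<noteq> 0 \<and> k * (c * x) = d * x \<and> k * (c * y) = d * y \<and> k * (c * z) = d * z"
    if "k \<noteq> 0" for k
    using assms that by (intro exI[of _ "k * c"]) simp
  ultimately show ?thesis unfolding proj_pt_def by fastforce
qed

lemma proj_pt_eqE:
  assumes "proj_pt (x, y, z) = proj_pt (x', y', z')"
  obtains c where "c \<noteq> 0" "x = c * x'" "y = c * y'" "z = c * z'"
proof -
  have "(x, y, z) \<in> proj_pt (x', y', z')" using proj_pt_self assms by metis
  then show ?thesis using that unfolding proj_pt_def by auto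
qed

lemma proj_pt_affine_eq_iff:
  "proj_pt (u, v, 1) = proj_pt (x, y, z) \<longleftrightarrow> z \<noteq> 0 \<and> x = u * z \<and> y = v * z"
proof
  assume "proj_pt (u, v, 1) = proj_pt (x, y, z)"
  then obtain c where "c \<noteq> 0" "u = c * x" "v = c * y" "1 = c * z" by (rule proj_pt_eqE)
  moreover from this have "z \<noteq> 0" by auto
  ultimately show "z \<noteq> 0 \<and> x = u * z \<and> y = v * z" by (simp add: field_simps)
next
  assume *: "z \<noteq> 0 \<and> x = u * z \<and> y = v * z"
  then show "proj_pt (u, v, 1) = proj_pt (x, y, z)"
    using proj_pt_scale[of z u v 1] by (simp add: mult.commute)
qed

lemma mem_legendre_curve_iff:
  "proj_pt (x, y, z) \<in> legendre_curve l \<longleftrightarrow>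
     (x, y, z) \<noteq> (0, 0, 0) \<and> y ^ 2 * z = x * (x - z) * (x - l * z)"
proof
  assume "proj_pt (x, y, z) \<in> legendre_curve l"
  then obtain x' y' z' where eq: "proj_pt (x, y, z) = proj_pt (x', y', z')"
    and *: "(x', y', z') \<noteq> (0, 0, 0)" "y' ^ 2 * z' = x' * (x' - z') * (x' - l * z')"
    unfolding legendre_curve_def by blast
  obtain c where c: "c \<noteq> 0" "x = c * x'" "y = c * y'" "z = c * z'" using eq by (rule proj_pt_eqE)
  have "y ^ 2 * z = c ^ 3 * (y' ^ 2 * z')"
    by (simp add: c power2_eq_square power3_eq_cube)
  also have "\<dots> = x * (x - z) * (x - l * z)"
    unfolding * by (simp add: c power3_eq_cube algebra_simps)
  finally show "(x, y, z) \<noteq> (0, 0, 0) \<and> y ^ 2 * z = x * (x - z) * (x - l * z)"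
    using * c by auto
qed (auto simp: legendre_curve_def)

lemma affine_mem_legendre_curve_iff: "proj_pt (x, y, 1) \<in> legendre_curve l \<longleftrightarrow> on_legendre l x y"
  by (simp add: mem_legendre_curve_iff on_legendre_def)

lemma point_O_not_affine: "proj_pt (x, y, 1) \<noteq> point_O"
  by (simp add: point_O_def proj_pt_affine_eq_iff)

lemma point_O_in_legendre_curve: "point_O \<in> legendre_curve l"
  by (simp add: point_O_def mem_legendre_curve_iff)

lemma legendre_curve_affineE:
  assumes "P \<in> legendre_curve l" "P \<noteq> point_O"
  obtains x y where "on_legendre l x y" "P = proj_pt (x, y, 1)"
proof -
  obtain x y z where P: "P = proj_pt (x, y, z)" using assms(1) unfolding legendre_curve_def by blast
  have "z \<noteq> 0"
  proof
    assume "z = 0"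
    then have "x = 0" "y \<noteq> 0" using assms(1) unfolding P mem_legendre_curve_iff by auto
    then show False using assms(2) \<open>z = 0\<close> proj_pt_scale[of y 0 1 0] unfolding P point_O_def by simp
  qed
  then have "P = proj_pt (x / z, y / z, 1)" unfolding P using proj_pt_affine_eq_iff[of "x / z" "y / z" x y z] by simp
  then show ?thesis using that assms(1) affine_mem_legendre_curve_iff by metis
qed

lemma regular_fun_form_eval: "regular_fun l (\<lambda>x y. form_eval d F (x, y, 1))"
  unfolding form_eval_def
  by (auto intro!: regular_fun_sum regular_fun_mult regular_fun_power regular_fun_const
      regular_fun_x regular_fun_y)

text \<open>
  On the affine part a form becomes a polynomial in \<open>x\<close> and \<open>y\<close>. If \<open>f\<close> is given by the forms
  \<open>F\<^sub>1, F\<^sub>2, F\<^sub>3\<close> where \<open>H \<noteq> 0\<close>, then \<open>F\<^sub>1 = U F\<^sub>3\<close> and \<open>F\<^sub>2 = V F\<^sub>3\<close> there, with \<open>F\<^sub>3 \<noteq> 0\<close> as the image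
  is affine. The local denominator to use is \<open>H F\<^sub>3\<close>: because of the factor \<open>H\<close> the equation
  \<open>(H F\<^sub>3) U = H F\<^sub>1\<close> holds on the entire curve.
\<close>

lemma morphism_affine_coordinates:
  fixes l m :: "'k::alg_closed_field"
  assumes f: "proj_morphism (legendre_curve l) (legendre_curve m) f"
    and affine: "\<And>P. P \<in> legendre_curve l \<Longrightarrow> P \<noteq> point_O \<Longrightarrow> f P \<noteq> point_O"
  shows "\<exists>U V. regular_fun l U \<and> regular_fun l V \<and> (\<forall>x y. on_legendre l x y \<longrightarrow>
    on_legendre m (U x y) (V x y) \<and> f (proj_pt (x, y, 1)) = proj_pt (U x y, V x y, 1))"
proof -
  have into: "f ` legendre_curve l \<subseteq> legendre_curve m"
    using f unfolding proj_morphism_def by (rule conjunct1)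
  have "\<exists>u v. on_legendre l x y \<longrightarrow> on_legendre m u v \<and> f (proj_pt (x, y, 1)) = proj_pt (u, v, 1)" for x y
  proof (cases "on_legendre l x y")
    case True
    then have P: "proj_pt (x, y, 1) \<in> legendre_curve l" by (simp add: affine_mem_legendre_curve_iff)
    obtain u v where "on_legendre m u v" "f (proj_pt (x, y, 1)) = proj_pt (u, v, 1)"
      by (rule legendre_curve_affineE[OF subsetD[OF into imageI[OF P]]
            affine[OF P point_O_not_affine]])
    then show ?thesis by blast
  qed blast
  then obtain U V where UV: "\<And>x y. on_legendre l x y \<Longrightarrow>
      on_legendre m (U x y) (V x y) \<and> f (proj_pt (x, y, 1)) = proj_pt (U x y, V x y, 1)"
    by metis
  have loc: "\<exists>h n n'. regular_fun l h \<and> regular_fun l n \<and> regular_fun l n' \<and> h x y \<noteq> 0 \<and>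
     (\<forall>x' y'. on_legendre l x' y' \<longrightarrow> h x' y' * U x' y' = n x' y' \<and> h x' y' * V x' y' = n' x' y')"
    if xy: "on_legendre l x y" for x y
  proof -
    have "proj_pt (x, y, 1) \<in> legendre_curve l" using xy by (simp add: affine_mem_legendre_curve_iff)
    from f[unfolded proj_morphism_def, THEN conjunct2, THEN spec, THEN mp, OF this]
    obtain e H d F1 F2 F3 where HF: "form_eval e H (x, y, 1) \<noteq> 0 \<and>
        (\<forall>w. proj_pt w \<in> legendre_curve l \<and> form_eval e H w \<noteq> 0 \<longrightarrow>
          (form_eval d F1 w, form_eval d F2 w, form_eval d F3 w) \<noteq> (0, 0, 0) \<and>
          f (proj_pt w) = proj_pt (form_eval d F1 w, form_eval d F2 w, form_eval d F3 w))"
      by (elim exE) (rule that)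
    have F: "f (proj_pt w) = proj_pt (form_eval d F1 w, form_eval d F2 w, form_eval d F3 w)"
      if "proj_pt w \<in> legendre_curve l" "form_eval e H w \<noteq> 0" for w
      using HF[THEN conjunct2, THEN spec, THEN mp, OF conjI, OF that] by (rule conjunct2)
    define h0 where "h0 = (\<lambda>x y. form_eval e H (x, y, 1))"
    define f1 where "f1 = (\<lambda>x y. form_eval d F1 (x, y, 1))"
    define f2 where "f2 = (\<lambda>x y. form_eval d F2 (x, y, 1))"
    define f3 where "f3 = (\<lambda>x y. form_eval d F3 (x, y, 1))"
    have reg: "regular_fun l h0" "regular_fun l f1" "regular_fun l f2" "regular_fun l f3"
      unfolding h0_def f1_def f2_def f3_def by (rule regular_fun_form_eval)+
    have eq: "f3 x' y' \<noteq> 0" "f1 x' y' = U x' y' * f3 x' y'" "f2 x' y' = V x' y' * f3 x' y'"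
      if "on_legendre l x' y'" "h0 x' y' \<noteq> 0" for x' y'
    proof -
      have "proj_pt (U x' y', V x' y', 1) = proj_pt (f1 x' y', f2 x' y', f3 x' y')"
        using F[of "(x', y', 1)"] UV[OF that(1)] that
        by (simp add: affine_mem_legendre_curve_iff h0_def f1_def f2_def f3_def)
      then show "f3 x' y' \<noteq> 0" "f1 x' y' = U x' y' * f3 x' y'" "f2 x' y' = V x' y' * f3 x' y'"
        by (simp_all add: proj_pt_affine_eq_iff)
    qed
    have "h0 x y \<noteq> 0" using HF by (simp add: h0_def)
    show ?thesis
    proof (intro exI conjI allI impI)
      show "regular_fun l (\<lambda>x y. h0 x y * f3 x y)" "regular_fun l (\<lambda>x y. h0 x y * f1 x y)"
        "regular_fun l (\<lambda>x y. h0 x y * f2 x y)"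
        using reg regular_fun_mult by blast+
      show "h0 x y * f3 x y \<noteq> 0" using eq(1)[OF xy] \<open>h0 x y \<noteq> 0\<close> by simp
      fix x' y' assume xy': "on_legendre l x' y'"
      show "h0 x' y' * f3 x' y' * U x' y' = h0 x' y' * f1 x' y'"
        "h0 x' y' * f3 x' y' * V x' y' = h0 x' y' * f2 x' y'"
        using eq(2,3)[OF xy'] by (cases "h0 x' y' = 0"; simp)+
    qed
  qed
  have "regular_fun l U" "regular_fun l V"
  proof -
    show "regular_fun l U"
    proof (rule locally_regular_imp_regular)
      fix x y assume "on_legendre l x y"
      from loc[OF this] obtain h n n' where *: "regular_fun l h \<and> regular_fun l n \<and> regular_fun l n' \<and>
          h x y \<noteq> 0 \<and> (\<forall>x' y'. on_legendre l x' y' \<longrightarrow>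
            h x' y' * U x' y' = n x' y' \<and> h x' y' * V x' y' = n' x' y')"
        by (elim exE) (rule that)
      show "\<exists>h n. regular_fun l h \<and> regular_fun l n \<and> h x y \<noteq> 0 \<and>
          (\<forall>x' y'. on_legendre l x' y' \<longrightarrow> h x' y' * U x' y' = n x' y')"
        using * by (intro exI[of _ h] exI[of _ n]) simp
    qed
    show "regular_fun l V"
    proof (rule locally_regular_imp_regular)
      fix x y assume "on_legendre l x y"
      from loc[OF this] obtain h n n' where *: "regular_fun l h \<and> regular_fun l n \<and> regular_fun l n' \<and>
          h x y \<noteq> 0 \<and> (\<forall>x' y'. on_legendre l x' y' \<longrightarrow>
            h x' y' * U x' y' = n x' y' \<and> h x' y' * V x' y' = n' x' y')"
        by (elim exE) (rule that)
      show "\<exists>h n. regular_fun l h \<and> regular_fun l n \<and> h x y \<noteq> 0 \<and>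
          (\<forall>x' y'. on_legendre l x' y' \<longrightarrow> h x' y' * V x' y' = n x' y')"
        using * by (intro exI[of _ h] exI[of _ n']) simp
    qed
  qed
  then show ?thesis using UV by blast
qed

lemma elliptic_iso_imp_affine_map:
  fixes l m :: "'k::alg_closed_field"
  assumes two: "(2::'k) \<noteq> 0" and iso: "elliptic_iso (legendre_curve l) (legendre_curve m)"
  shows "\<exists>\<alpha> \<beta> \<gamma>. \<alpha> \<noteq> 0 \<and> \<gamma> \<noteq> 0 \<and>
    (\<forall>x. (\<alpha> * x + \<beta>) * (\<alpha> * x + \<beta> - 1) * (\<alpha> * x + \<beta> - m) = \<gamma> ^ 2 * (x * (x - 1) * (x - l)))"
proof -
  define C where "C = legendre_curve l"
  define D where "D = legendre_curve m"
  obtain f where bij: "bij_betw f C D" and f: "proj_morphism C D f"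
    and inv: "proj_morphism D C (inv_into C f)" and fO: "f point_O = point_O"
    using iso unfolding elliptic_iso_def C_def D_def by blast
  define g where "g = inv_into C f"
  have g': "proj_morphism D C g" using inv by (simp add: g_def)
  have gf: "g (f P) = P" if "P \<in> C" for P
    using bij that by (simp add: g_def bij_betw_def)
  have fg: "f (g Q) = Q" "g Q \<in> C" if "Q \<in> D" for Q
    using bij that by (auto simp: g_def bij_betw_def f_inv_into_f inv_into_into)
  have O: "point_O \<in> C" "point_O \<in> D" unfolding C_def D_def by (rule point_O_in_legendre_curve)+
  have gO: "g point_O = point_O" using gf[OF O(1)] fO by simp
  have f_affine: "f P \<noteq> point_O" if "P \<in> C" "P \<noteq> point_O" for P
    using gf that gO by metis
  have g_affine: "g Q \<noteq> point_O" if "Q \<in> D" "Q \<noteq> point_O" for Q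
    using fg that fO by metis
  obtain U V where U: "regular_fun l U" and V: "regular_fun l V"
    and UV: "\<And>x y. on_legendre l x y \<Longrightarrow> on_legendre m (U x y) (V x y)"
    and fUV: "\<And>x y. on_legendre l x y \<Longrightarrow> f (proj_pt (x, y, 1)) = proj_pt (U x y, V x y, 1)"
    using morphism_affine_coordinates[OF f[unfolded C_def D_def] f_affine[unfolded C_def]] by blast
  obtain U' V' where U': "regular_fun m U'" and V': "regular_fun m V'"
    and gUV: "\<And>x y. on_legendre m x y \<Longrightarrow> g (proj_pt (x, y, 1)) = proj_pt (U' x y, V' x y, 1)"
    using morphism_affine_coordinates[OF g'[unfolded C_def D_def] g_affine[unfolded D_def]] by blast
  have inv: "U' (U x y) (V x y) = x" "V' (U x y) (V x y) = y" if xy: "on_legendre l x y" for x y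
  proof -
    have "g (f (proj_pt (x, y, 1))) = proj_pt (x, y, 1)"
      using gf xy affine_mem_legendre_curve_iff unfolding C_def by blast
    then have "proj_pt (x, y, 1) = proj_pt (U' (U x y) (V x y), V' (U x y) (V x y), 1)"
      using fUV[OF xy] gUV[OF UV[OF xy]] by simp
    then show "U' (U x y) (V x y) = x" "V' (U x y) (V x y) = y"
      by (simp_all add: proj_pt_affine_eq_iff)
  qed
  \<comment> \<open>Surjectivity makes \<open>U\<close> take the values 0 and 1, so it is not constant.\<close>
  have U_value: "\<exists>x y. on_legendre l x y \<and> U x y = u" if uv: "on_legendre m u v" for u v
  proof -
    have Q: "proj_pt (u, v, 1) \<in> D" using uv by (simp add: D_def affine_mem_legendre_curve_iff)
    then obtain x y where xy: "on_legendre l x y" "g (proj_pt (u, v, 1)) = proj_pt (x, y, 1)"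
      using fg(2)[OF Q] g_affine[OF Q point_O_not_affine] legendre_curve_affineE unfolding C_def by metis
    then have "proj_pt (u, v, 1) = proj_pt (U x y, V x y, 1)" using fg(1)[OF Q] fUV by simp
    then show ?thesis using xy by (auto simp: proj_pt_affine_eq_iff)
  qed
  have "on_legendre m 0 0" "on_legendre m 1 0" by (simp_all add: on_legendre_def)
  then obtain x0 y0 x1 y1
    where "on_legendre l x0 y0" "on_legendre l x1 y1" "U x0 y0 = 0" "U x1 y1 = 1"
    using U_value by meson
  then have "on_legendre l x0 y0" "on_legendre l x1 y1" "U x0 y0 \<noteq> U x1 y1" by auto
  from affine_iso_imp_linear[OF two U V U' V' UV inv this] show ?thesis .
qed

section \<open>Isomorphism of Legendre curves and the anharmonic group\<close>

text \<open>
  The orbit of \<open>l\<close> under the six fractional linear maps permuting \<open>0, 1, \<infinity>\<close>, i.e. the values of the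
  cross ratio of \<open>0, 1, \<infinity>, l\<close> in all orders.
\<close>

definition anharmonic_orbit :: "'k::field \<Rightarrow> 'k set" where
  "anharmonic_orbit l = {l, 1 - l, 1 / l, 1 - 1 / l, 1 / (1 - l), l / (l - 1)}"

lemma distinct_triple_cases:
  assumes "x \<in> {a, b, c}" "y \<in> {a, b, c}" "z \<in> {a, b, c}" "y \<noteq> x" "z \<noteq> x" "z \<noteq> y"
  shows "(x, y, z) \<in> {(a, b, c), (a, c, b), (b, a, c), (b, c, a), (c, a, b), (c, b, a)}"
  using assms by auto

text \<open>
  The affine map \<open>x \<mapsto> \<alpha> x + \<beta>\<close> carries the roots \<open>0, 1, l\<close> of one cubic to the roots \<open>0, 1, m\<close> of the
  other. Each of the six ways to do so gives one of the six values of \<open>m\<close>.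
\<close>

lemma elliptic_iso_imp_anharmonic:
  fixes l m :: "'k::alg_closed_field"
  assumes two: "(2::'k) \<noteq> 0" and l: "l \<noteq> 0" "l \<noteq> 1"
    and iso: "elliptic_iso (legendre_curve l) (legendre_curve m)"
  shows "m \<in> anharmonic_orbit l"
proof -
  obtain \<alpha> \<beta> \<gamma> where \<alpha>: "\<alpha> \<noteq> 0" and
    eq: "\<And>x. (\<alpha> * x + \<beta>) * (\<alpha> * x + \<beta> - 1) * (\<alpha> * x + \<beta> - m) = \<gamma> ^ 2 * (x * (x - 1) * (x - l))"
    using elliptic_iso_imp_affine_map[OF two iso] by metis
  have "\<beta> \<in> {0, 1, m}" "\<alpha> + \<beta> \<in> {0, 1, m}" "\<alpha> * l + \<beta> \<in> {0, 1, m}"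
    using eq[of 0] eq[of 1] eq[of l] by auto
  moreover have "\<alpha> + \<beta> \<noteq> \<beta>" "\<alpha> * l + \<beta> \<noteq> \<beta>" "\<alpha> * l + \<beta> \<noteq> \<alpha> + \<beta>" using \<alpha> l by auto
  ultimately have "(\<beta>, \<alpha> + \<beta>, \<alpha> * l + \<beta>) \<in>
      {(0, 1, m), (0, m, 1), (1, 0, m), (1, m, 0), (m, 0, 1), (m, 1, 0)}"
    by (rule distinct_triple_cases)
  then consider "\<beta> = 0" "\<alpha> + \<beta> = 1" "\<alpha> * l + \<beta> = m"
    | "\<beta> = 0" "\<alpha> + \<beta> = m" "\<alpha> * l + \<beta> = 1"
    | "\<beta> = 1" "\<alpha> + \<beta> = 0" "\<alpha> * l + \<beta> = m"
    | "\<beta> = 1" "\<alpha> + \<beta> = m" "\<alpha> * l + \<beta> = 0"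
    | "\<beta> = m" "\<alpha> + \<beta> = 0" "\<alpha> * l + \<beta> = 1"
    | "\<beta> = m" "\<alpha> + \<beta> = 1" "\<alpha> * l + \<beta> = 0"
    unfolding insert_iff empty_iff prod.inject by argo
  then show ?thesis
  proof cases
    case 1
    then show ?thesis by (simp add: anharmonic_orbit_def)
  next
    case 2
    then have "m = 1 / l" using l by (simp add: field_simps)
    then show ?thesis by (simp add: anharmonic_orbit_def)
  next
    case 3
    then have "\<alpha> = -1" by (simp add: eq_neg_iff_add_eq_0)
    with 3 have "m = 1 - l" by simp
    then show ?thesis by (simp add: anharmonic_orbit_def)
  next
    case 4
    then have "\<alpha> = m - 1" by (simp add: algebra_simps)
    with 4 have "m = 1 - 1 / l" using l by (simp add: field_simps)
    then show ?thesis by (simp add: anharmonic_orbit_def)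
  next
    case 5
    then have "\<alpha> = - m" by (simp add: eq_neg_iff_add_eq_0)
    with 5 have "m * (1 - l) = 1" by (simp add: algebra_simps)
    then have "m = 1 / (1 - l)" using l by (simp add: field_simps)
    then show ?thesis by (simp add: anharmonic_orbit_def)
  next
    case 6
    then have "\<alpha> = 1 - m" by (simp add: algebra_simps)
    with 6 have "m * (l - 1) = l" by (simp add: algebra_simps)
    then have "m = l / (l - 1)" using l by (simp add: field_simps)
    then show ?thesis by (simp add: anharmonic_orbit_def)
  qed
qed

lemma linear_image_proj_pt:
  "(\<lambda>(x, y, z). (\<alpha> * x + \<beta> * z, \<gamma> * y, z)) ` proj_pt (x, y, z) =
     proj_pt (\<alpha> * x + \<beta> * z, \<gamma> * y, z :: 'k::field)"
proof -
  have "(\<alpha> * (c * x) + \<beta> * (c * z), \<gamma> * (c * y), c * z) =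
      (c * (\<alpha> * x + \<beta> * z), c * (\<gamma> * y), c * z)" for c
    by (simp add: algebra_simps)
  then show ?thesis
    unfolding proj_pt_def prod.case setcompr_eq_image image_image by (simp only:)
qed

text \<open>
  Linear substitutions are morphisms: three forms of degree \<open>1\<close> work everywhere, with the constant
  form \<open>1\<close> of degree \<open>0\<close> as \<open>H\<close>.
\<close>

lemma linear_proj_morphism:
  fixes C D :: "('k::field \<times> 'k \<times> 'k) set set"
  assumes "\<alpha> \<noteq> 0" "\<gamma> \<noteq> 0"
    and f: "\<And>x y z. proj_pt (x, y, z) \<in> C \<Longrightarrow> f (proj_pt (x, y, z)) = proj_pt (\<alpha> * x + \<beta> * z, \<gamma> * y, z)"
    and into: "f ` C \<subseteq> D"
    and nonzero: "\<And>v. proj_pt v \<in> C \<Longrightarrow> v \<noteq> (0, 0, 0)"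
  shows "proj_morphism C D f"
proof -
  define F1 where "F1 = (\<lambda>(i::nat) (j::nat). if i = Suc 0 then \<alpha> else if j = Suc 0 then 0 else \<beta>)"
  define F2 where "F2 = (\<lambda>(i::nat) (j::nat). if j = Suc 0 then \<gamma> else 0)"
  define F3 where "F3 = (\<lambda>(i::nat) (j::nat). if i = 0 \<and> j = 0 then 1 else 0 :: 'k)"
  have ev: "form_eval 1 F1 (x, y, z) = \<alpha> * x + \<beta> * z" "form_eval 1 F2 (x, y, z) = \<gamma> * y"
    "form_eval 1 F3 (x, y, z) = z" for x y z
    by (simp_all add: form_eval_def F1_def F2_def F3_def numeral_eq_Suc)
  have one: "form_eval 0 (\<lambda>_ _. 1 :: 'k) v = 1" for v
    by (cases v) (simp add: form_eval_def)
  have "(form_eval 1 F1 w, form_eval 1 F2 w, form_eval 1 F3 w) \<noteq> (0, 0, 0) \<and>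
      f (proj_pt w) = proj_pt (form_eval 1 F1 w, form_eval 1 F2 w, form_eval 1 F3 w)"
    if "proj_pt w \<in> C" for w
  proof -
    obtain x y z where w: "w = (x, y, z)" by (cases w)
    show ?thesis
      using f[of x y z] nonzero[of w] that assms(1,2) unfolding w ev by auto
  qed
  then show ?thesis
    unfolding proj_morphism_def using into one by (metis one_neq_zero)
qed

lemma linear_elliptic_iso:
  fixes l m :: "'k::field"
  assumes \<alpha>: "\<alpha> \<noteq> 0" and \<gamma>: "\<gamma> ^ 2 = \<alpha> ^ 3"
    and eq: "\<And>x z. (\<alpha> * x + \<beta> * z) * (\<alpha> * x + \<beta> * z - z) * (\<alpha> * x + \<beta> * z - m * z) =
       \<alpha> ^ 3 * (x * (x - z) * (x - l * z))"
  shows "elliptic_iso (legendre_curve l) (legendre_curve m)"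
proof -
  have \<gamma>0: "\<gamma> \<noteq> 0" using \<alpha> \<gamma> by auto
  define C where "C = legendre_curve l"
  define D where "D = legendre_curve m"
  define f where "f = (\<lambda>P. (\<lambda>(x, y, z). (\<alpha> * x + \<beta> * z, \<gamma> * y, z)) ` P)"
  define g where "g = (\<lambda>P. (\<lambda>(x, y, z). ((1 / \<alpha>) * x + (- \<beta> / \<alpha>) * z, (1 / \<gamma>) * y, z)) ` P)"
  have f: "f (proj_pt (x, y, z)) = proj_pt (\<alpha> * x + \<beta> * z, \<gamma> * y, z)" for x y z
    unfolding f_def by (rule linear_image_proj_pt)
  have g: "g (proj_pt (x, y, z)) = proj_pt ((1 / \<alpha>) * x + (- \<beta> / \<alpha>) * z, (1 / \<gamma>) * y, z)" for x y z
    unfolding g_def by (rule linear_image_proj_pt)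
  have curve_pt: "\<exists>x y z. P = proj_pt (x, y, z)" if "P \<in> C \<or> P \<in> D" for P
    using that unfolding C_def D_def legendre_curve_def by blast
  have gf: "g (f P) = P" if "P \<in> C" for P
    using curve_pt[of P] that \<alpha> \<gamma>0 by (auto simp: f g add_divide_distrib)
  have fg: "f (g P) = P" if "P \<in> D" for P
    using curve_pt[of P] that \<alpha> \<gamma>0 by (auto simp: f g algebra_simps)
  have curves: "proj_pt (\<alpha> * x + \<beta> * z, \<gamma> * y, z) \<in> D \<longleftrightarrow> proj_pt (x, y, z) \<in> C" for x y z
  proof -
    have "(\<gamma> * y) ^ 2 * z = \<alpha> ^ 3 * (y ^ 2 * z)" by (simp add: power_mult_distrib \<gamma>)
    then show ?thesis
      using \<alpha> \<gamma>0 unfolding C_def D_def mem_legendre_curve_iff eq by auto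
  qed
  have fC: "f P \<in> D" if "P \<in> C" for P
    using curve_pt[of P] that curves f by auto
  have gD: "g P \<in> C" if P: "P \<in> D" for P
  proof -
    obtain x y z where xyz: "P = proj_pt (x, y, z)" using curve_pt P by blast
    then have "f (g P) = proj_pt (\<alpha> * ((1 / \<alpha>) * x + (- \<beta> / \<alpha>) * z) + \<beta> * z, \<gamma> * ((1 / \<gamma>) * y), z)"
      by (simp only: f g)
    then show ?thesis using fg[OF P] P curves unfolding xyz g by metis
  qed
  have bij: "bij_betw f C D"
    by (rule bij_betw_byWitness[where f' = g]) (use gf fg fC gD in auto)
  have inv: "inv_into C f P = g P" if "P \<in> D" for P
    using inv_into_f_eq[OF bij_betw_imp_inj_on[OF bij] gD[OF that] fg[OF that]] .
  have nonzero: "v \<noteq> (0, 0, 0)" if "proj_pt v \<in> C \<or> proj_pt v \<in> D" for v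
    using that unfolding C_def D_def by (cases v) (auto simp: mem_legendre_curve_iff)
  have "proj_morphism C D f"
    by (rule linear_proj_morphism[OF \<alpha> \<gamma>0, of _ _ \<beta>]) (use f fC nonzero in auto)
  moreover have "proj_morphism D C (inv_into C f)"
  proof (rule linear_proj_morphism)
    show "1 / \<alpha> \<noteq> 0" "1 / \<gamma> \<noteq> 0" using \<alpha> \<gamma>0 by auto
    show "inv_into C f (proj_pt (x, y, z)) = proj_pt ((1 / \<alpha>) * x + (- \<beta> / \<alpha>) * z, (1 / \<gamma>) * y, z)"
      if "proj_pt (x, y, z) \<in> D" for x y z
      using inv[OF that] g by simp
    show "inv_into C f ` D \<subseteq> C" using inv gD by auto
  qed (use nonzero in blast)
  moreover have "f point_O = point_O"
    using proj_pt_scale[of \<gamma> 0 1 0] \<gamma>0 unfolding point_O_def f by simp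
  ultimately show ?thesis
    using bij unfolding elliptic_iso_def C_def D_def by blast
qed

text \<open>
  Conversely, each of the six values of \<open>m\<close> comes with an affine map carrying \<open>0, 1, l\<close> to \<open>0, 1, m\<close>
  in some order. It lifts to the curves once \<open>y\<close> is scaled by a square root of \<open>\<alpha>\<^sup>3\<close>.
\<close>

lemma anharmonic_imp_elliptic_iso:
  fixes l m :: "'k::alg_closed_field"
  assumes l: "l \<noteq> 0" "l \<noteq> 1" and m: "m \<in> anharmonic_orbit l"
  shows "elliptic_iso (legendre_curve l) (legendre_curve m)"
proof -
  have prod: "(t - p * z) * (t - q * z) * (t - r * z) = t * (t - z) * (t - m * z)"
    if "(p, q, r) \<in> {(0, 1, m), (0, m, 1), (1, 0, m), (1, m, 0), (m, 0, 1), (m, 1, 0)}"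
    for p q r t z
    using that by auto
  have perm: ?thesis
    if \<alpha>: "\<alpha> \<noteq> 0" and roots: "(\<beta>, \<alpha> + \<beta>, \<alpha> * l + \<beta>) \<in>
        {(0, 1, m), (0, m, 1), (1, 0, m), (1, m, 0), (m, 0, 1), (m, 1, 0)}" for \<alpha> \<beta>
  proof -
    obtain \<gamma> where "\<gamma> ^ 2 = \<alpha> ^ 3" using nth_root_exists[of 2 "\<alpha> ^ 3"] by auto
    moreover have "(\<alpha> * x + \<beta> * z) * (\<alpha> * x + \<beta> * z - z) * (\<alpha> * x + \<beta> * z - m * z) =
       \<alpha> ^ 3 * (x * (x - z) * (x - l * z))" for x z
    proof -
      define t where "t = \<alpha> * x + \<beta> * z"
      have "\<alpha> ^ 3 * (x * (x - z) * (x - l * z)) =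
          (t - \<beta> * z) * (t - (\<alpha> + \<beta>) * z) * (t - (\<alpha> * l + \<beta>) * z)"
        by (simp add: t_def power3_eq_cube algebra_simps)
      also have "\<dots> = t * (t - z) * (t - m * z)"
        by (rule prod[OF roots])
      finally show ?thesis by (simp add: t_def)
    qed
    ultimately show ?thesis using linear_elliptic_iso \<alpha> by blast
  qed
  have l1: "1 - l \<noteq> 0" "l - 1 \<noteq> 0" using l by auto
  consider "m = l" | "m = 1 - l" | "m = 1 / l" | "m = 1 - 1 / l" | "m = 1 / (1 - l)" | "m = l / (l - 1)"
    using m unfolding anharmonic_orbit_def by blast
  then show ?thesis
  proof cases
    case 1
    then show ?thesis by (intro perm[of 1 0]) auto
  next
    case 2
    then show ?thesis by (intro perm[of "-1" 1]) auto
  next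
    case 3
    then show ?thesis using l by (intro perm[of "1 / l" 0]) auto
  next
    case 4
    then show ?thesis using l by (intro perm[of "- 1 / l" 1]) auto
  next
    case 5
    then show ?thesis using l l1 by (intro perm[of "- 1 / (1 - l)" "1 / (1 - l)"]) (auto simp: divide_simps)
  next
    case 6
    then show ?thesis using l l1 by (intro perm[of "- 1 / (l - 1)" "l / (l - 1)"]) (auto simp: divide_simps)
  qed
qed

section \<open>Counting the orbits of the anharmonic group\<close>
text \<open>
  The orbit of \<open>-1\<close> (where \<open>j = 1728\<close>) and the set of roots of \<open>t\<^sup>2 - t + 1\<close>, which is an orbit
  (where \<open>j = 0\<close>) or empty. Outside characteristics 2 and 3, the orbits on the elements other than
  \<open>0\<close> and \<open>1\<close> with fewer than six members are among these two.
\<close>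

definition harmonic_orbit :: "'k::field set" where
  "harmonic_orbit = {-1, 2, 1 / 2}"

definition equianharmonic_orbit :: "'k::field set" where
  "equianharmonic_orbit = {t. t * t - t + 1 = 0}"

lemma anharmonic_sixth_value:
  assumes "l \<noteq> (1 :: 'k::field)"
  shows "l / (l - 1) = 1 - 1 / (1 - l)"
  using assms by (auto simp: divide_simps) (auto simp: algebra_simps)

text \<open>
  The maps \<open>l \<mapsto> 1 - l\<close> and \<open>l \<mapsto> 1 / l\<close> generate the group, so it suffices that they preserve orbits.
\<close>

lemma anharmonic_orbit_one_minus:
  assumes "l \<noteq> 0" "l \<noteq> (1 :: 'k::field)"
  shows "anharmonic_orbit (1 - l) = anharmonic_orbit l"
proof -
  have "1 - 1 / (1 - l) = l / (l - 1)" "(1 - l) / (1 - l - 1) = 1 - 1 / l"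
    using assms by (auto simp: divide_simps) (auto simp: algebra_simps)
  then show ?thesis by (auto simp: anharmonic_orbit_def)
qed

lemma anharmonic_orbit_inverse:
  assumes "l \<noteq> 0" "l \<noteq> (1 :: 'k::field)"
  shows "anharmonic_orbit (1 / l) = anharmonic_orbit l"
proof -
  have "1 / (1 / l) = l" "1 / (1 - 1 / l) = l / (l - 1)" "(1 / l) / (1 / l - 1) = 1 / (1 - l)"
    using assms by (simp_all add: divide_simps)
  then show ?thesis by (simp add: anharmonic_orbit_def insert_commute)
qed

lemma anharmonic_orbit_eq:
  assumes l: "l \<noteq> 0" "l \<noteq> (1 :: 'k::field)" and m: "m \<in> anharmonic_orbit l"
  shows "anharmonic_orbit m = anharmonic_orbit l" and "m \<noteq> 0" and "m \<noteq> 1"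
proof -
  note F = anharmonic_sixth_value[OF l(2)]
  have ne: "1 - l \<noteq> 0" "1 - l \<noteq> 1" "1 / l \<noteq> 0" "1 / l \<noteq> 1" "1 / (1 - l) \<noteq> 0" "1 / (1 - l) \<noteq> 1"
    using l by (auto simp: divide_simps)
  have ne': "1 - 1 / l \<noteq> 0" "1 - 1 / l \<noteq> 1" "1 - 1 / (1 - l) \<noteq> 0" "1 - 1 / (1 - l) \<noteq> 1"
    using l by (auto simp: divide_simps)
  have D: "anharmonic_orbit (1 - 1 / l) = anharmonic_orbit l"
    using anharmonic_orbit_one_minus[OF ne(3,4)] anharmonic_orbit_inverse[OF l] by simp
  have E: "anharmonic_orbit (1 / (1 - l)) = anharmonic_orbit l"
    using anharmonic_orbit_inverse[OF ne(1,2)] anharmonic_orbit_one_minus[OF l] by simp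
  have F': "anharmonic_orbit (1 - 1 / (1 - l)) = anharmonic_orbit l"
    using anharmonic_orbit_one_minus[OF ne(5,6)] E by simp
  have "m \<in> {l, 1 - l, 1 / l, 1 - 1 / l, 1 / (1 - l), 1 - 1 / (1 - l)}"
    using m unfolding anharmonic_orbit_def F .
  then consider "m = l" | "m = 1 - l" | "m = 1 / l" | "m = 1 - 1 / l" | "m = 1 / (1 - l)"
    | "m = 1 - 1 / (1 - l)" by blast
  then have "anharmonic_orbit m = anharmonic_orbit l \<and> m \<noteq> 0 \<and> m \<noteq> 1"
  proof cases
    case 1
    then show ?thesis using l by simp
  next
    case 2
    show ?thesis unfolding 2 using anharmonic_orbit_one_minus[OF l] ne by blast
  next
    case 3
    show ?thesis unfolding 3 using anharmonic_orbit_inverse[OF l] ne by blast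
  next
    case 4
    show ?thesis unfolding 4 using D ne' by blast
  next
    case 5
    show ?thesis unfolding 5 using E ne by blast
  next
    case 6
    show ?thesis unfolding 6 using F' ne' by blast
  qed
  then show "anharmonic_orbit m = anharmonic_orbit l" "m \<noteq> 0" "m \<noteq> 1" by blast+
qed

lemma anharmonic_orbit_self: "l \<in> anharmonic_orbit l"
  by (simp add: anharmonic_orbit_def)

lemma two_three_nonzero:
  assumes "(6 :: 'k::field) \<noteq> 0"
  shows "(2 :: 'k) \<noteq> 0" and "(3 :: 'k) \<noteq> 0"
proof -
  have "(2 :: 'k) * 3 = 6" by simp
  then show "(2 :: 'k) \<noteq> 0" "(3 :: 'k) \<noteq> 0" using assms by (metis mult_zero_left, metis mult_zero_right)
qed

text \<open>
  Two of the six values coincide only if \<open>l \<in> {-1, 2, 1/2}\<close> or \<open>l\<^sup>2 - l + 1 = 0\<close>.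
  With the inverses \<open>i\<close> of \<open>l\<close> and \<open>j\<close> of \<open>1 - l\<close> the values are \<open>l, i, j\<close> and their complements to 1.
\<close>

lemma card_generic_anharmonic_orbit:
  assumes l: "l \<noteq> 0" "l \<noteq> (1 :: 'k::field)"
    and h: "l \<notin> harmonic_orbit" and e: "l \<notin> equianharmonic_orbit"
  shows "card (anharmonic_orbit l) = 6"
proof -
  define i where "i = 1 / l"
  define j where "j = 1 / (1 - l)"
  have i: "l * i = 1" and j: "j * (1 - l) = 1" using l by (simp_all add: i_def j_def)
  have orbit: "anharmonic_orbit l = {l, 1 - l, i, 1 - i, j, 1 - j}"
  proof -
    have "l / (l - 1) = 1 - j" using anharmonic_sixth_value[OF l(2)] by (simp add: j_def)
    then show ?thesis by (simp add: anharmonic_orbit_def i_def j_def)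
  qed
  have n: "l * l - l + 1 \<noteq> 0" "l \<noteq> 2" "l + 1 \<noteq> 0"
    using h e by (auto simp: harmonic_orbit_def equianharmonic_orbit_def eq_neg_iff_add_eq_0)
  have n2: "2 * l \<noteq> 1"
  proof
    assume *: "2 * l = 1"
    then have "(2 :: 'k) \<noteq> 0" by auto
    with * have "l = 1 / 2" by (simp add: field_simps)
    then show False using h by (simp add: harmonic_orbit_def)
  qed
  have "l \<noteq> 1 - l" using n2 by (metis diff_add_cancel mult_2)
  moreover have li: "l \<noteq> i"
  proof
    assume "l = i"
    with i have "(l - 1) * (l + 1) = 0" by (simp add: algebra_simps)
    then show False using l n(3) by simp
  qed
  moreover have "l \<noteq> 1 - i"
  proof
    assume "l = 1 - i"
    then have "l * l = l * (1 - i)" by simp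
    then show False using i n(1) by (simp add: algebra_simps)
  qed
  moreover have lj: "l \<noteq> j"
  proof
    assume "l = j"
    then show False using j n(1) by (simp add: algebra_simps)
  qed
  moreover have lj': "1 - l \<noteq> j"
  proof
    assume "1 - l = j"
    then have "(1 - l) * (1 - l) = 1" using j by simp
    moreover have "l * (l - 2) = (1 - l) * (1 - l) - 1" by (simp add: algebra_simps)
    ultimately have "l * (l - 2) = 0" by simp
    then show False using l n(2) by simp
  qed
  moreover have "l \<noteq> 1 - j" using lj' by auto
  moreover have "1 - l \<noteq> i"
  proof
    assume "1 - l = i"
    then have "l * (1 - l) = l * i" by simp
    then show False using i n(1) by (simp add: algebra_simps)
  qed
  moreover have "1 - l \<noteq> 1 - i" "1 - l \<noteq> 1 - j" using li lj by simp_all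
  moreover have "i \<noteq> 1 - i"
  proof
    assume "i = 1 - i"
    then have "l * i = l * (1 - i)" by simp
    then have "1 = l - 1" unfolding right_diff_distrib i by simp
    then have "2 = l" by (metis diff_add_cancel one_add_one)
    then show False using n(2) by simp
  qed
  moreover have ij: "i \<noteq> j"
  proof
    assume "i = j"
    then have "l * (j * (1 - l)) = 1 - l" using i by (simp add: mult.assoc[symmetric])
    then have "l = 1 - l" using j by simp
    then show False using n2 by (metis diff_add_cancel mult_2)
  qed
  moreover have ij': "1 - i \<noteq> j"
  proof
    assume "1 - i = j"
    then have "l * ((1 - i) * (1 - l)) = l" using j by simp
    moreover have "l * ((1 - i) * (1 - l)) = (l - l * i) * (1 - l)" by (simp add: algebra_simps)
    ultimately have "(l - 1) * (1 - l) = l" unfolding i by simp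
    then show False using n(1) by (simp add: algebra_simps)
  qed
  moreover have "i \<noteq> 1 - j" using ij' by auto
  moreover have "1 - i \<noteq> 1 - j" using ij by simp
  moreover have "j \<noteq> 1 - j"
  proof
    assume "j = 1 - j"
    then have "j * (1 - l) = (1 - j) * (1 - l)" by simp
    then have "1 = (1 - l) - 1" using j by (simp add: left_diff_distrib)
    moreover have "l + 1 = 1 - ((1 - l) - 1)" by simp
    ultimately have "l + 1 = 0" by (metis diff_self)
    then show False using n(3) by simp
  qed
  ultimately show ?thesis unfolding orbit by simp
qed

lemma anharmonic_orbit_minus_one:
  assumes "(6 :: 'k::field) \<noteq> 0"
  shows "anharmonic_orbit (-1 :: 'k) = harmonic_orbit" and "card (harmonic_orbit :: 'k set) = 3"
proof -
  note nz = two_three_nonzero[OF assms]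
  have half: "x = 1 / 2 \<longleftrightarrow> 2 * x = 1" for x :: 'k
    using nz(1) by (auto simp: field_simps)
  have "(-1 :: 'k) / (-1 - 1) = 1 / 2" "1 / (1 - (-1 :: 'k)) = 1 / 2"
    using nz(1) by (simp_all add: half)
  then show "anharmonic_orbit (-1 :: 'k) = harmonic_orbit"
    by (auto simp: anharmonic_orbit_def harmonic_orbit_def)
  have "(-1 :: 'k) \<noteq> 2" "2 * (-1 :: 'k) \<noteq> 1" "2 * (2 :: 'k) \<noteq> 1"
  proof -
    have "(2 :: 'k) - (-1) = 3" "1 - 2 * (-1 :: 'k) = 3" "2 * (2 :: 'k) - 1 = 3" by simp_all
    then show "(-1 :: 'k) \<noteq> 2" "2 * (-1 :: 'k) \<noteq> 1" "2 * (2 :: 'k) \<noteq> 1"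
      using nz(2) by (metis diff_self)+
  qed
  then have "(-1 :: 'k) \<noteq> 2" "(-1 :: 'k) \<noteq> 1 / 2" "(2 :: 'k) \<noteq> 1 / 2"
    unfolding half by blast+
  then show "card (harmonic_orbit :: 'k set) = 3" by (simp add: harmonic_orbit_def)
qed

lemma anharmonic_orbit_equianharmonic:
  assumes six: "(6 :: 'k::field) \<noteq> 0" and l: "(l :: 'k) \<in> equianharmonic_orbit"
  shows "l \<noteq> 0" "l \<noteq> 1" "anharmonic_orbit l = equianharmonic_orbit"
    and "card (equianharmonic_orbit :: 'k set) = 2"
proof -
  note nz = two_three_nonzero[OF six]
  have eq: "l * l - l + 1 = 0" using l by (simp add: equianharmonic_orbit_def)
  then show l01: "l \<noteq> 0" "l \<noteq> 1" by auto
  have "l * (1 - l) = 1 - (l * l - l + 1)" by (simp add: algebra_simps)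
  then have "l * (1 - l) = 1" unfolding eq by simp
  then have inv: "1 / l = 1 - l" "1 / (1 - l) = l" using l01 by (simp_all add: field_simps)
  note F = anharmonic_sixth_value[OF l01(2)]
  have orbit: "anharmonic_orbit l = {l, 1 - l}"
    unfolding anharmonic_orbit_def F inv by auto
  have "t = l \<or> t = 1 - l" if "t * t - t + 1 = 0" for t
  proof -
    have "(t - l) * (t - (1 - l)) = (t * t - t + 1) - (l * l - l + 1)" by (simp add: algebra_simps)
    then have "(t - l) * (t - (1 - l)) = 0" unfolding that eq by simp
    then show ?thesis by simp
  qed
  moreover have "(1 - l) * (1 - l) - (1 - l) + 1 = l * l - l + 1" by (simp add: algebra_simps)
  ultimately have set: "equianharmonic_orbit = {l, 1 - l}"
    using eq unfolding equianharmonic_orbit_def by auto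
  show "anharmonic_orbit l = equianharmonic_orbit" unfolding orbit set ..
  have "l \<noteq> 1 - l"
  proof
    assume "l = 1 - l"
    then have double: "l + l = 1" by (metis diff_add_cancel)
    have "(l + l) * (l + l) - (l + l) - (l + l) + 4 = 4 * (l * l - l + 1)" by (simp add: algebra_simps)
    then have "(3 :: 'k) = 0" unfolding double eq by simp
    then show False using nz(2) by simp
  qed
  then show "card (equianharmonic_orbit :: 'k set) = 2" unfolding set by simp
qed

text \<open>
  The \<open>q - 2\<close> elements other than \<open>0\<close> and \<open>1\<close> fall into \<open>k\<close> orbits of size \<open>6\<close>, the harmonic orbit of
  size \<open>3\<close>, and the equianharmonic one of size \<open>2\<close> if it is nonempty. So \<open>q = 6 k + 5\<close> with \<open>k + 1\<close>
  orbits, or \<open>q = 6 k + 7\<close> with \<open>k + 2\<close> orbits. The residue of \<open>q\<close> modulo \<open>6\<close> thus decides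
  between the two cases.
\<close>

lemma count_anharmonic_orbits:
  assumes six: "(6 :: 'q::{field, finite}) \<noteq> 0"
  defines "N \<equiv> card (anharmonic_orbit ` (UNIV - {0, 1 :: 'q}))"
  shows "CARD('q) + 1 = 6 * N \<or> CARD('q) + 5 = 6 * N"
proof -
  define L where "L = UNIV - {0, 1 :: 'q}"
  define H where "H = (harmonic_orbit :: 'q set)"
  define E where "E = (equianharmonic_orbit :: 'q set)"
  define G where "G = L - H - E"
  note nz = two_three_nonzero[OF six]
  note harm = anharmonic_orbit_minus_one[OF six, folded H_def]
  note equi = anharmonic_orbit_equianharmonic[OF six, folded E_def]
  have m1: "(-1 :: 'q) \<noteq> 0" "(-1 :: 'q) \<noteq> 1"
    using nz(1) by (auto simp: neg_eq_iff_add_eq_0)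
  have orbitH: "anharmonic_orbit l = H" if "l \<in> H" for l
    using anharmonic_orbit_eq(1)[OF m1, of l] that harm by simp
  have HL: "H \<subseteq> L"
    using anharmonic_orbit_eq(2,3)[OF m1] harm(1) unfolding L_def by blast
  have EL: "E \<subseteq> L" using equi(1,2) unfolding L_def by blast
  have HE: "H \<inter> E = {}"
  proof (rule ccontr)
    assume "H \<inter> E \<noteq> {}"
    then obtain l where l: "l \<in> H" "l \<in> E" by blast
    then have "H = E" using orbitH[OF l(1)] equi(3)[OF l(2)] by simp
    then show False using harm(2) equi(4)[OF l(2)] by simp
  qed
  have closed: "anharmonic_orbit l \<subseteq> G" if l: "l \<in> G" for l
  proof
    fix m assume m: "m \<in> anharmonic_orbit l"
    have l01: "l \<noteq> 0" "l \<noteq> 1" using l unfolding G_def L_def by blast+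
    note orb = anharmonic_orbit_eq[OF l01 m]
    have "m \<in> L" using orb(2,3) by (simp add: L_def)
    moreover have "m \<notin> H" "m \<notin> E"
      using orbitH[of m] equi(3)[of m] orb(1) anharmonic_orbit_self[of l] l unfolding G_def by auto
    ultimately show "m \<in> G" by (simp add: G_def)
  qed
  have card6: "card (anharmonic_orbit l) = 6" if "l \<in> G" for l
    using that card_generic_anharmonic_orbit[of l] unfolding G_def L_def H_def E_def by blast
  have UnG: "\<Union> (anharmonic_orbit ` G) = G"
    using closed anharmonic_orbit_self by blast
  have G: "6 * card (anharmonic_orbit ` G) = card G"
  proof -
    have "6 * card (anharmonic_orbit ` G) = card (\<Union> (anharmonic_orbit ` G))"
    proof (rule card_partition)
      fix A B assume A: "A \<in> anharmonic_orbit ` G" and B: "B \<in> anharmonic_orbit ` G" and "A \<noteq> B"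
      from A obtain a where a: "a \<in> G" "A = anharmonic_orbit a" by blast
      from B obtain b where b: "b \<in> G" "B = anharmonic_orbit b" by blast
      have ab: "a \<noteq> 0" "a \<noteq> 1" "b \<noteq> 0" "b \<noteq> 1" using a b unfolding G_def L_def by blast+
      show "A \<inter> B = {}"
        using anharmonic_orbit_eq(1)[OF ab(1,2)] anharmonic_orbit_eq(1)[OF ab(3,4)] \<open>A \<noteq> B\<close>
        unfolding a(2) b(2) by blast
    qed (use card6 in auto)
    then show ?thesis unfolding UnG .
  qed
  have Lsplit: "L = G \<union> (H \<union> E)" using HL EL unfolding G_def by blast
  have "card L = card G + (card H + card E)"
    unfolding Lsplit by (subst card_Un_disjoint; (subst card_Un_disjoint)?) (use HE in \<open>auto simp: G_def\<close>)
  then have cardL: "card L = 6 * card (anharmonic_orbit ` G) + (3 + card E)"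
    using G harm(2) by simp
  have L2: "card L + 2 = CARD('q)"
    using card_Diff_subset[of "{0, 1 :: 'q}" UNIV] card_mono[of UNIV "{0, 1 :: 'q}"]
    by (simp add: L_def)
  have "-1 \<in> H" by (simp add: H_def harmonic_orbit_def)
  then have imH: "anharmonic_orbit ` H = {H}" using orbitH by auto
  have HG: "H \<notin> anharmonic_orbit ` G" using card6 harm(2) by force
  show ?thesis
  proof (cases "E = {}")
    case True
    then have "anharmonic_orbit ` L = insert H (anharmonic_orbit ` G)"
      unfolding Lsplit image_Un imH by simp
    then have "N = card (anharmonic_orbit ` G) + 1"
      using HG by (simp add: N_def L_def[symmetric])
    then show ?thesis using L2 cardL True by simp
  next
    case False
    then have imE: "anharmonic_orbit ` E = {E}" and E2: "card E = 2" using equi(3,4) by auto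
    have "anharmonic_orbit ` L = insert E (insert H (anharmonic_orbit ` G))"
      unfolding Lsplit image_Un imH imE by simp
    moreover have "E \<notin> insert H (anharmonic_orbit ` G)" using card6 E2 harm(2) by force
    ultimately have "N = card (anharmonic_orbit ` G) + 2"
      using HG by (simp add: N_def L_def[symmetric])
    then show ?thesis using L2 cardL E2 by simp
  qed
qed

lemma anharmonic_orbit_to_ac: "anharmonic_orbit (to_ac l) = to_ac ` anharmonic_orbit l"
  by (simp add: anharmonic_orbit_def)

lemma elliptic_iso_legendre_iff:
  fixes l m :: "'k::alg_closed_field"
  assumes "(2 :: 'k) \<noteq> 0" "l \<noteq> 0" "l \<noteq> 1"
  shows "elliptic_iso (legendre_curve l) (legendre_curve m) \<longleftrightarrow> m \<in> anharmonic_orbit l"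
  using assms elliptic_iso_imp_anharmonic anharmonic_imp_elliptic_iso by metis

text \<open>
  Via \<open>a \<mapsto> (2 - a) / 4\<close> the classes correspond to orbits in the finite field itself: the anharmonic maps
  have coefficients in the prime field, so isomorphism over the algebraic closure between curves with
  parameters in the finite field amounts to lying in the same orbit there.
\<close>

lemma card_jacobi_classes:
  assumes two: "(2 :: 'q::{field, finite}) \<noteq> 0"
  shows "card ((jacobi_params :: 'q set) // jacobi_iso) = card (anharmonic_orbit ` (UNIV - {0, 1 :: 'q}))"
proof -
  define p where "p = (\<lambda>a :: 'q. (2 - a) / 4)"
  have four: "(4 :: 'q) \<noteq> 0" using two by (metis mult_2 mult_eq_0_iff numeral_Bit0)
  have inj: "inj p" using four by (simp add: inj_def p_def)
  have p_inv: "p (2 - 4 * l) = l" for l using four by (simp add: p_def)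
  have surj: "surj p" by (rule surjI) (rule p_inv)
  have params: "a \<in> jacobi_params \<longleftrightarrow> p a \<noteq> 0 \<and> p a \<noteq> 1" for a
  proof -
    have "(2 - a) * (2 + a) = 4 - a ^ 2" by (simp add: algebra_simps power2_eq_square)
    then have "a ^ 2 = 4 \<longleftrightarrow> (2 - a) * (2 + a) = 0" by (metis eq_iff_diff_eq_0)
    moreover have "p a = 0 \<longleftrightarrow> 2 - a = 0" using four by (simp add: p_def)
    moreover have "p a = 1 \<longleftrightarrow> 2 + a = 0"
    proof -
      have "(2 - a) - 4 = - (2 + a)" by simp
      then have "2 - a = 4 \<longleftrightarrow> 2 + a = 0" by (metis eq_iff_diff_eq_0 neg_equal_0_iff_equal)
      then show ?thesis using four by (simp add: p_def)
    qed
    ultimately show ?thesis by (simp add: jacobi_params_def)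
  qed
  have two': "(2 :: 'q alg_closure) \<noteq> 0" using two by (metis to_ac_eq_0_iff to_ac_numeral)
  have iso: "(a, b) \<in> jacobi_iso \<longleftrightarrow>
      a \<in> jacobi_params \<and> b \<in> jacobi_params \<and> p b \<in> anharmonic_orbit (p a)" for a b
  proof (cases "a \<in> jacobi_params")
    case True
    have p': "(2 - to_ac c) / 4 = to_ac (p c)" for c by (simp add: p_def)
    have "elliptic_iso (jacobi_elliptic (to_ac a)) (jacobi_elliptic (to_ac b)) \<longleftrightarrow>
        to_ac (p b) \<in> to_ac ` anharmonic_orbit (p a)"
      unfolding jacobi_elliptic_def p' anharmonic_orbit_to_ac[symmetric]
      using True two' unfolding params by (intro elliptic_iso_legendre_iff) auto
    then show ?thesis
      by (simp add: jacobi_iso_def inj_image_mem_iff[OF inj_to_ac])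
  qed (simp add: jacobi_iso_def)
  have class_image: "p ` (jacobi_iso `` {a}) = anharmonic_orbit (p a)" if a: "a \<in> jacobi_params" for a
  proof -
    have "jacobi_iso `` {a} = p -` anharmonic_orbit (p a)"
      using a iso params anharmonic_orbit_eq(2,3)[of "p a"] by auto
    then show ?thesis by (simp only: surj_image_vimage_eq[OF surj])
  qed
  have "image p ` (jacobi_params // jacobi_iso) = (\<lambda>a. anharmonic_orbit (p a)) ` jacobi_params"
    unfolding quotient_def UNION_singleton_eq_range image_image
    by (rule image_cong[OF refl class_image])
  also have "\<dots> = anharmonic_orbit ` (p ` jacobi_params)" by (simp add: image_image)
  also have "p ` jacobi_params = UNIV - {0, 1}"
  proof -
    have eq: "jacobi_params = p -` (UNIV - {0, 1})" using params by auto
    show ?thesis unfolding eq by (rule surj_image_vimage_eq[OF surj])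
  qed
  finally have "image p ` (jacobi_params // jacobi_iso) = anharmonic_orbit ` (UNIV - {0, 1})" .
  moreover have "inj_on (image p) (jacobi_params // jacobi_iso)"
    using inj by (meson inj_image_eq_iff inj_onI)
  ultimately show ?thesis by (metis card_image)
qed

theorem theorem3p3:
  fixes q :: nat and N\<^sub>a :: nat
  assumes char: "CHAR('q::{field, finite}) > 3"
    and q: "q = CARD('q)"
    and N: "N\<^sub>a = card ((jacobi_params :: 'q set) // jacobi_iso)"
  shows "(q mod 12 = 1 \<or> q mod 12 = 7 \<longrightarrow> rat_of_nat N\<^sub>a = (rat_of_nat q + 5) / 6) \<and>
         (q mod 12 = 5 \<or> q mod 12 = 11 \<longrightarrow> rat_of_nat N\<^sub>a = (rat_of_nat q + 1) / 6)"
proof -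
  have nz: "of_nat n \<noteq> (0 :: 'q)" if "0 < n" "n \<le> 3" for n
    using char that nat_dvd_not_less[of n "CHAR('q)"] by (simp add: of_nat_eq_0_iff_char_dvd nat_dvd_not_less)
  have "(2 :: 'q) \<noteq> 0" "(3 :: 'q) \<noteq> 0" using nz[of 2] nz[of 3] by simp_all
  then have "(2 :: 'q) * 3 \<noteq> 0" by (simp only: mult_eq_0_iff simp_thms)
  then have six: "(6 :: 'q) \<noteq> 0" by simp
  have N': "q + 1 = 6 * N\<^sub>a \<or> q + 5 = 6 * N\<^sub>a"
    using count_anharmonic_orbits[OF six] card_jacobi_classes[OF \<open>(2 :: 'q) \<noteq> 0\<close>] q N by simp
  have eq: "rat_of_nat N\<^sub>a = (rat_of_nat q + rat_of_nat c) / 6" if "q + c = 6 * N\<^sub>a" for c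
  proof -
    have "rat_of_nat (q + c) = rat_of_nat (6 * N\<^sub>a)" using that by simp
    then show ?thesis by simp
  qed
  have "q + 5 = 6 * N\<^sub>a" if "q mod 12 = 1 \<or> q mod 12 = 7"
    using N' that by presburger
  moreover have "q + 1 = 6 * N\<^sub>a" if "q mod 12 = 5 \<or> q mod 12 = 11"
    using N' that by presburger
  ultimately show ?thesis using eq[of 5] eq[of 1] by auto
qed

end
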